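(* Let $p\geqslant 3$ be a prime and let $G$ be a finite $p$-group such that $|G'/G''|=p^3$ and $G''\neq 1$. Then $|G'/\gamma_3(G)|=p$ and $G''=\gamma_5(G)$.
   Context: For a group $G$, $\gamma_i(G)$ denotes the $i$-th term of the lower central series: $\gamma_1(G)=G$ and $\gamma_{i+1}(G)=[\gamma_i(G),G]$. Thus $\gamma_2(G)=G'$ is the derived subgroup; $G''=(G')'$ is the second derived subgroup. *)

theory Defs
  imports "HOL-Algebra.Algebra" "HOL-Computational_Algebra.Primes"
begin

(* Same commutator h k h^-1 k^-1 as in the library's derived subgroup.  The convention
   h^-1 k^-1 h k would generate the same subgroup whenever H and K are subgroups. *)
definition commutator_subgroup ::
    "('a, 'b) monoid_scheme \<Rightarrow> 'a set \<Rightarrow> 'a set \<Rightarrow> 'a set" where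
  "commutator_subgroup G H K =
     generate G {h \<otimes>\<^bsub>G\<^esub> k \<otimes>\<^bsub>G\<^esub> inv\<^bsub>G\<^esub> h \<otimes>\<^bsub>G\<^esub> inv\<^bsub>G\<^esub> k | h k. h \<in> H \<and> k \<in> K}"

(* Indexed from 1: the first term is the whole group; index 0 is a dummy value. *)
fun lower_central :: "('a, 'b) monoid_scheme \<Rightarrow> nat \<Rightarrow> 'a set" where
  "lower_central G 0 = carrier G"
| "lower_central G (Suc 0) = carrier G"
| "lower_central G (Suc (Suc n)) =
     commutator_subgroup G (lower_central G (Suc n)) (carrier G)"

lemma commutator_subgroup_self: "commutator_subgroup G H H = derived G H"
  unfolding commutator_subgroup_def derived_def
  by (rule arg_cong[where f = "generate G"]) blast

lemma lower_central_2: "lower_central G 2 = derived G (carrier G)"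
  by (simp add: numeral_2_eq_2 commutator_subgroup_self)

end

theory Submission
  imports Defs
begin

text \<open>Write \<open>G\<^sub>i\<close> for the lower central series. Since \<open>1 \<noteq> G'' \<subseteq> G\<^sub>4\<close>, the chain
  \<open>G\<^sub>2 \<supset> G\<^sub>3 \<supset> G\<^sub>4 \<supset> G\<^sub>5\<close> is strict. If \<open>|G\<^sub>2/G\<^sub>3| = p\<close>, then \<open>G'' \<subseteq> G\<^sub>5\<close>
  and counting leaves only \<open>G'' = G\<^sub>5\<close>. Otherwise \<open>|G\<^sub>2/G\<^sub>3| = p\<^sup>2\<close>, \<open>|G\<^sub>3/G\<^sub>4| = p\<close> and
  \<open>G'' = G\<^sub>4\<close>, and after passing to a quotient \<open>G\<^sub>4\<close> is central of order \<open>p\<close>. There the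
  centralizer \<open>K\<close> of \<open>G\<^sub>3\<close> generates \<open>G\<close> together with any \<open>a \<notin> K\<close>, and \<open>[K,K]\<close> lies in
  the centre \<open>G\<^sub>3\<close> of \<open>G\<^sub>2\<close>; so \<open>[x,a]\<close> and \<open>[y,a]\<close> fail to commute for some
  \<open>x, y \<in> K\<close>. But the Jacobi identity for \<open>x, y, a\<close> forces the square of
  \<open>[[x,a],[y,a]]\<close> to be trivial, which is impossible for odd \<open>p\<close>.\<close>

section \<open>Commutators and centralizers\<close>

text \<open>The convention is that of the library's \<open>derived_set\<close>. With it,
  \<open>x \<otimes> y = commutator G x y \<otimes> y \<otimes> x\<close>, so swapping two letters
  leaves the commutator on the left.\<close>

definition commutator :: "('a, 'b) monoid_scheme \<Rightarrow> 'a \<Rightarrow> 'a \<Rightarrow> 'a" where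
  "commutator G x y = x \<otimes>\<^bsub>G\<^esub> y \<otimes>\<^bsub>G\<^esub> inv\<^bsub>G\<^esub> x \<otimes>\<^bsub>G\<^esub> inv\<^bsub>G\<^esub> y"

text \<open>Always taken in the ambient group: the centre of a subgroup \<open>A\<close> appears as
  \<open>A \<inter> centralizer G A\<close>.\<close>

definition centralizer :: "('a, 'b) monoid_scheme \<Rightarrow> 'a set \<Rightarrow> 'a set" where
  "centralizer G S = {g \<in> carrier G. \<forall>s\<in>S. g \<otimes>\<^bsub>G\<^esub> s = s \<otimes>\<^bsub>G\<^esub> g}"

abbreviation center :: "('a, 'b) monoid_scheme \<Rightarrow> 'a set" where
  "center G \<equiv> centralizer G (carrier G)"

lemma mem_centralizer_iff:
  "g \<in> centralizer G S \<longleftrightarrow> g \<in> carrier G \<and> (\<forall>s\<in>S. g \<otimes>\<^bsub>G\<^esub> s = s \<otimes>\<^bsub>G\<^esub> g)"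
  by (auto simp: centralizer_def)

lemma derived_set_eq_commutators:
  "derived_set G H = {commutator G h k | h k. h \<in> H \<and> k \<in> H}"
  by (auto simp: commutator_def)

lemma commutator_subgroup_eq:
  "commutator_subgroup G H K = generate G {commutator G h k | h k. h \<in> H \<and> k \<in> K}"
  by (simp add: commutator_subgroup_def commutator_def)

context group
begin

text \<open>Together with \<open>word_simps\<close>, these let the simplifier cancel inverse pairs
  inside right-associated words, which proves the elementary commutator identities by
  rewriting.\<close>

lemma inv_cancel_left [simp]:
  assumes "x \<in> carrier G" "y \<in> carrier G"
  shows "inv x \<otimes> (x \<otimes> y) = y" and "x \<otimes> (inv x \<otimes> y) = y"
  using assms by (simp_all flip: m_assoc)

lemmas word_simps = m_assoc inv_mult_group

lemma commutator_closed [simp, intro]: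
  "x \<in> carrier G \<Longrightarrow> y \<in> carrier G \<Longrightarrow> commutator G x y \<in> carrier G"
  by (simp add: commutator_def)

lemma commutator_mult_swap:
  "x \<in> carrier G \<Longrightarrow> y \<in> carrier G \<Longrightarrow> x \<otimes> y = commutator G x y \<otimes> y \<otimes> x"
  by (simp add: commutator_def word_simps)

lemma inv_commutator:
  "x \<in> carrier G \<Longrightarrow> y \<in> carrier G \<Longrightarrow> inv (commutator G x y) = commutator G y x"
  by (simp add: commutator_def word_simps)

lemma commutator_eq_one_iff:
  assumes "x \<in> carrier G" "y \<in> carrier G"
  shows "commutator G x y = \<one> \<longleftrightarrow> x \<otimes> y = y \<otimes> x"
proof
  assume "commutator G x y = \<one>"
  then show "x \<otimes> y = y \<otimes> x"
    using commutator_mult_swap[OF assms] assms by simp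
next
  assume "x \<otimes> y = y \<otimes> x"
  then show "commutator G x y = \<one>"
    using assms by (simp add: commutator_def word_simps)
qed

lemma commutator_mult_left:
  assumes "x \<in> carrier G" "y \<in> carrier G" "z \<in> carrier G"
  shows "commutator G (x \<otimes> y) z = x \<otimes> commutator G y z \<otimes> inv x \<otimes> commutator G x z"
  using assms by (simp add: commutator_def word_simps)

lemma commutator_inv_left:
  assumes "x \<in> carrier G" "y \<in> carrier G"
  shows "commutator G (inv x) y = inv x \<otimes> inv (commutator G x y) \<otimes> inv (inv x)"
  using assms by (simp add: commutator_def word_simps)

lemma commute_inv:
  assumes "x \<in> carrier G" "y \<in> carrier G" "x \<otimes> y = y \<otimes> x"
  shows "inv x \<otimes> y = y \<otimes> inv x"
  by (metis assms inv_closed inv_solve_left inv_solve_right m_assoc m_closed)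

lemma subgroup_centralizer:
  assumes "S \<subseteq> carrier G" shows "subgroup (centralizer G S) G"
proof
  fix x y assume x: "x \<in> centralizer G S" and y: "y \<in> centralizer G S"
  have "x \<otimes> y \<otimes> s = s \<otimes> (x \<otimes> y)" if s: "s \<in> S" for s
  proof -
    have "x \<in> carrier G" "y \<in> carrier G" "s \<in> carrier G" "x \<otimes> s = s \<otimes> x" "y \<otimes> s = s \<otimes> y"
      using x y s assms by (auto simp: mem_centralizer_iff)
    then show ?thesis by (metis m_assoc)
  qed
  then show "x \<otimes> y \<in> centralizer G S"
    using x y by (simp add: mem_centralizer_iff)
qed (use assms in \<open>auto simp: mem_centralizer_iff subset_iff intro: commute_inv\<close>)

lemma normal_central:
  assumes "subgroup M G" "M \<subseteq> center G" shows "M \<lhd> G"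
proof (rule normal_invI[OF assms(1)])
  fix x h assume x: "x \<in> carrier G" and h: "h \<in> M"
  then have "h \<in> carrier G" "h \<otimes> x = x \<otimes> h"
    using assms by (auto simp: mem_centralizer_iff)
  then show "x \<otimes> h \<otimes> inv x \<in> M"
    using h x by (metis m_assoc r_inv r_one inv_closed)
qed

text \<open>Conjugation by \<open>g\<close> and \<open>h\<close> changes \<open>w\<close> by factors from \<open>S\<close>, so \<open>g h\<close> and
  \<open>h g\<close> act alike on \<open>w\<close>.\<close>
lemma commutator_commutes:
  assumes g: "g \<in> carrier G" and h: "h \<in> carrier G" and w: "w \<in> carrier G"
    and S: "S \<subseteq> carrier G"
    and cg: "commutator G g w \<in> S" and ch: "commutator G h w \<in> S"
    and gS: "\<And>s. s \<in> S \<Longrightarrow> g \<otimes> s = s \<otimes> g" and hS: "\<And>s. s \<in> S \<Longrightarrow> h \<otimes> s = s \<otimes> h"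
    and SS: "\<And>s t. s \<in> S \<Longrightarrow> t \<in> S \<Longrightarrow> s \<otimes> t = t \<otimes> s"
  shows "commutator G g h \<otimes> w = w \<otimes> commutator G g h"
proof -
  let ?c = "commutator G g w" and ?d = "commutator G h w" and ?e = "commutator G g h"
  have cd: "?c \<in> carrier G" "?d \<in> carrier G" "?e \<in> carrier G" using g h w by auto
  have 1: "x \<otimes> y \<otimes> w = commutator G y w \<otimes> commutator G x w \<otimes> w \<otimes> (x \<otimes> y)"
    if xy: "x \<in> carrier G" "y \<in> carrier G"
      and xd: "x \<otimes> commutator G y w = commutator G y w \<otimes> x" for x y
  proof -
    have cl: "commutator G y w \<in> carrier G" "commutator G x w \<in> carrier G" using xy w by auto
    have "x \<otimes> y \<otimes> w = x \<otimes> (y \<otimes> w)" using xy w by (simp add: m_assoc)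
    also have "\<dots> = (x \<otimes> commutator G y w) \<otimes> w \<otimes> y"
      using commutator_mult_swap[of y w] xy w cl by (simp add: m_assoc)
    also have "\<dots> = commutator G y w \<otimes> (x \<otimes> w) \<otimes> y"
      unfolding xd using xy w cl by (simp add: m_assoc)
    also have "\<dots> = commutator G y w \<otimes> commutator G x w \<otimes> w \<otimes> (x \<otimes> y)"
      using commutator_mult_swap[of x w] xy w cl by (simp add: m_assoc)
    finally show ?thesis .
  qed
  have "g \<otimes> h \<otimes> w = ?c \<otimes> ?d \<otimes> w \<otimes> (g \<otimes> h)"
    using 1[OF g h gS[OF ch]] SS[OF cg ch] by simp
  moreover have "h \<otimes> g \<otimes> w = ?c \<otimes> ?d \<otimes> w \<otimes> (h \<otimes> g)"
    using 1[OF h g hS[OF cg]] .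
  moreover have gh: "g \<otimes> h = ?e \<otimes> (h \<otimes> g)"
    using commutator_mult_swap[OF g h] g h by (simp add: m_assoc)
  ultimately have "?e \<otimes> (?c \<otimes> ?d \<otimes> w \<otimes> (h \<otimes> g)) = ?c \<otimes> ?d \<otimes> w \<otimes> (?e \<otimes> (h \<otimes> g))"
    using g h w cd by (simp add: m_assoc)
  then have "?e \<otimes> (?c \<otimes> ?d \<otimes> w) = ?c \<otimes> ?d \<otimes> w \<otimes> ?e"
    using g h w cd by (metis (no_types, lifting) m_assoc m_closed r_cancel)
  moreover have "?e \<otimes> s = s \<otimes> ?e" if s: "s \<in> S" for s
  proof -
    have sc: "s \<in> carrier G" using s S by auto
    have *: "subgroup (centralizer G {s}) G" using sc by (simp add: subgroup_centralizer)
    have "g \<in> centralizer G {s}" "h \<in> centralizer G {s}"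
      using s gS hS g h by (auto simp: mem_centralizer_iff)
    then have "?e \<in> centralizer G {s}"
      unfolding commutator_def by (intro subgroup.m_closed[OF *] subgroup.m_inv_closed[OF *])
    then show ?thesis by (simp add: mem_centralizer_iff)
  qed
  ultimately show ?thesis
    using cg ch cd w
    by (smt (verit) m_assoc m_closed l_cancel)
qed

section \<open>Commutators with values in a given subgroup\<close>

lemma normal_commutator_left:
  assumes "N \<lhd> G" "x \<in> N" "g \<in> carrier G" shows "commutator G x g \<in> N"
proof -
  interpret N: normal N G by fact
  have "x \<in> carrier G" using assms N.subset by blast
  moreover have "g \<otimes> inv x \<otimes> inv g \<in> N"
    using N.inv_op_closed2[OF assms(3) N.m_inv_closed[OF assms(2)]] .
  ultimately show ?thesis
    using assms N.m_closed[OF assms(2)] by (simp add: commutator_def m_assoc)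
qed

lemma commutator_flip_mem:
  assumes "subgroup H G" "x \<in> carrier G" "y \<in> carrier G" "commutator G x y \<in> H"
  shows "commutator G y x \<in> H"
  using subgroup.m_inv_closed[OF assms(1,4)] inv_commutator[OF assms(2,3)] by simp

lemma commutator_in_derived:
  "x \<in> K \<Longrightarrow> y \<in> K \<Longrightarrow> commutator G x y \<in> derived G K"
  unfolding derived_def derived_set_eq_commutators by (rule generate.incl) blast

lemma derived_subset_iff:
  assumes "subgroup H G"
  shows "derived G K \<subseteq> H \<longleftrightarrow> (\<forall>x\<in>K. \<forall>y\<in>K. commutator G x y \<in> H)"
proof
  assume "\<forall>x\<in>K. \<forall>y\<in>K. commutator G x y \<in> H"
  then show "derived G K \<subseteq> H"
    unfolding derived_def derived_set_eq_commutators
    by (intro generate_subgroup_incl[OF _ assms]) blast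
qed (use commutator_in_derived in blast)

text \<open>When all \<open>[g,w]\<close> are central, \<open>g \<mapsto> [g,w]\<close> is a
  homomorphism into an abelian group and so kills commutators. Here this is
  \<open>commutator_commutes\<close> with the centre as \<open>S\<close>.\<close>

lemma derived_commutes:
  assumes "w \<in> carrier G" "\<And>g. g \<in> carrier G \<Longrightarrow> commutator G g w \<in> center G"
  shows "derived G (carrier G) \<subseteq> centralizer G {w}"
proof -
  have "commutator G x y \<in> centralizer G {w}" if xy: "x \<in> carrier G" "y \<in> carrier G" for x y
  proof -
    have "commutator G x y \<otimes> w = w \<otimes> commutator G x y"
    proof (rule commutator_commutes[OF xy assms(1) _ assms(2)[OF xy(1)] assms(2)[OF xy(2)]])
      show "center G \<subseteq> carrier G" by (auto simp: mem_centralizer_iff)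
    next
      fix s assume "s \<in> center G"
      then have s: "s \<in> carrier G" "\<And>g. g \<in> carrier G \<Longrightarrow> s \<otimes> g = g \<otimes> s"
        by (simp_all add: mem_centralizer_iff)
      show "x \<otimes> s = s \<otimes> x" "y \<otimes> s = s \<otimes> y" using s(2) xy by metis+
      fix t assume "t \<in> center G"
      then show "s \<otimes> t = t \<otimes> s" using s(2) by (metis mem_centralizer_iff)
    qed
    then show ?thesis using xy by (simp add: mem_centralizer_iff)
  qed
  then show ?thesis
    using assms(1) by (simp add: derived_subset_iff subgroup_centralizer)
qed

section \<open>Jacobi-type identities from collecting words of three letters\<close>

text \<open>The word \<open>y a u\<close> is collected in two ways, starting with \<open>a u\<close>
  or with \<open>y a\<close>; both end in \<open>q r u y a\<close>, the second with the extra
  central factor \<open>[a,q] [v,u]\<close>. This is the Jacobi identity for \<open>y, a, u\<close>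
  with its third term absent because \<open>y\<close> commutes with \<open>[a,u]\<close>.\<close>

lemma commutator_exchange:
  assumes car: "u \<in> carrier G" "y \<in> carrier G" "a \<in> carrier G"
    and v: "v = commutator G y a" and q: "q = commutator G y u" and r: "r = commutator G a u"
    and com: "r \<otimes> q = q \<otimes> r" "y \<otimes> r = r \<otimes> y" "v \<otimes> q = q \<otimes> v" "v \<otimes> r = r \<otimes> v"
    and cen: "commutator G a q \<in> center G" "commutator G v u \<in> center G"
  shows "commutator G a q \<otimes> commutator G v u = \<one>"
proof -
  let ?e = "commutator G a q" and ?m = "commutator G v u"
  have cl: "v \<in> carrier G" "q \<in> carrier G" "r \<in> carrier G" "?e \<in> carrier G" "?m \<in> carrier G"
    using car v q r by auto
  note cl = cl car
  have ya: "y \<otimes> a = v \<otimes> a \<otimes> y" and yu: "y \<otimes> u = q \<otimes> u \<otimes> y" and au: "a \<otimes> u = r \<otimes> u \<otimes> a"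
    and aq: "a \<otimes> q = ?e \<otimes> q \<otimes> a" and vu: "v \<otimes> u = ?m \<otimes> u \<otimes> v"
    unfolding v q r by (rule commutator_mult_swap; use car in simp)+
  have e: "g \<otimes> ?e = ?e \<otimes> g" and m: "g \<otimes> ?m = ?m \<otimes> g" if "g \<in> carrier G" for g
    using cen that by (auto simp: mem_centralizer_iff)
  have "y \<otimes> a \<otimes> u = (y \<otimes> r) \<otimes> u \<otimes> a" using au cl by (simp add: m_assoc)
  also have "\<dots> = r \<otimes> (y \<otimes> u) \<otimes> a" unfolding com using cl by (simp add: m_assoc)
  also have "\<dots> = (r \<otimes> q) \<otimes> u \<otimes> (y \<otimes> a)" unfolding yu using cl by (simp add: m_assoc)
  finally have 1: "y \<otimes> a \<otimes> u = q \<otimes> r \<otimes> u \<otimes> (y \<otimes> a)" unfolding com .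
  have "y \<otimes> a \<otimes> u = v \<otimes> a \<otimes> (y \<otimes> u)" unfolding ya using cl by (simp add: m_assoc)
  also have "\<dots> = v \<otimes> (a \<otimes> q) \<otimes> u \<otimes> y" unfolding yu using cl by (simp add: m_assoc)
  also have "\<dots> = (v \<otimes> ?e) \<otimes> q \<otimes> (a \<otimes> u) \<otimes> y" unfolding aq using cl by (simp add: m_assoc)
  also have "\<dots> = ?e \<otimes> (v \<otimes> q) \<otimes> r \<otimes> u \<otimes> a \<otimes> y"
    unfolding e[OF cl(1)] au using cl by (simp add: m_assoc)
  also have "\<dots> = ?e \<otimes> q \<otimes> (v \<otimes> r) \<otimes> u \<otimes> a \<otimes> y"
    unfolding com(3) using cl by (simp add: m_assoc)
  also have "\<dots> = ?e \<otimes> q \<otimes> r \<otimes> (v \<otimes> u) \<otimes> a \<otimes> y"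
    unfolding com(4) using cl by (simp add: m_assoc)
  also have "\<dots> = ?e \<otimes> (q \<otimes> r \<otimes> ?m) \<otimes> u \<otimes> (v \<otimes> a \<otimes> y)"
    unfolding vu using cl by (simp add: m_assoc)
  also have "\<dots> = ?e \<otimes> ?m \<otimes> (q \<otimes> r \<otimes> u \<otimes> (y \<otimes> a))"
    unfolding ya[symmetric] using m[of "q \<otimes> r"] cl by (simp add: m_assoc)
  finally have "?e \<otimes> ?m \<otimes> (q \<otimes> r \<otimes> u \<otimes> (y \<otimes> a)) = q \<otimes> r \<otimes> u \<otimes> (y \<otimes> a)"
    using 1 by simp
  then show ?thesis using cl by (simp add: l_cancel_one)
qed

text \<open>The word \<open>x y a\<close> is brought to the form \<open>c \<dots> a y x\<close> in
  two ways, starting with \<open>x y\<close> or with \<open>y a\<close>; cancelling \<open>c\<close>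
  and \<open>a y x\<close> compares the factors in between. If \<open>[u,v]\<close> is central as
  well, the result says that \<open>q\<close> and \<open>q'\<close> agree modulo the centre.\<close>

lemma commutator_jacobi:
  assumes car: "x \<in> carrier G" "y \<in> carrier G" "a \<in> carrier G"
    and u: "u = commutator G x a" and v: "v = commutator G y a" and c: "c = commutator G x y"
    and q: "q = commutator G y u" and q': "q' = commutator G x v"
    and com: "c \<otimes> u = u \<otimes> c" "c \<otimes> v = v \<otimes> c" "c \<otimes> q' = q' \<otimes> c"
    and cen: "commutator G a c \<in> center G"
  shows "q \<otimes> (u \<otimes> v) = q' \<otimes> (v \<otimes> u) \<otimes> commutator G a c"
proof -
  let ?e = "commutator G a c"
  have cl: "u \<in> carrier G" "v \<in> carrier G" "c \<in> carrier G" "q \<in> carrier G" "q' \<in> carrier G"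
      "?e \<in> carrier G"
    using car u v c q q' by auto
  note cl = cl car
  have xy: "x \<otimes> y = c \<otimes> y \<otimes> x" and xa: "x \<otimes> a = u \<otimes> a \<otimes> x" and ya: "y \<otimes> a = v \<otimes> a \<otimes> y"
    and yu: "y \<otimes> u = q \<otimes> u \<otimes> y" and xv: "x \<otimes> v = q' \<otimes> v \<otimes> x" and ac: "a \<otimes> c = ?e \<otimes> c \<otimes> a"
    using cl unfolding u v c q q' by (auto intro: commutator_mult_swap)
  have e: "g \<otimes> ?e = ?e \<otimes> g" if "g \<in> carrier G" for g
    using cen that by (auto simp: mem_centralizer_iff)
  have "x \<otimes> y \<otimes> a = c \<otimes> y \<otimes> (x \<otimes> a)" unfolding xy using cl by (simp add: m_assoc)
  also have "\<dots> = c \<otimes> (y \<otimes> u) \<otimes> a \<otimes> x" unfolding xa using cl by (simp add: m_assoc)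
  also have "\<dots> = c \<otimes> q \<otimes> u \<otimes> (y \<otimes> a) \<otimes> x" unfolding yu using cl by (simp add: m_assoc)
  also have "\<dots> = c \<otimes> (q \<otimes> (u \<otimes> v)) \<otimes> (a \<otimes> y \<otimes> x)" unfolding ya using cl by (simp add: m_assoc)
  finally have 1: "x \<otimes> y \<otimes> a = c \<otimes> (q \<otimes> (u \<otimes> v)) \<otimes> (a \<otimes> y \<otimes> x)" .
  have "x \<otimes> y \<otimes> a = x \<otimes> (y \<otimes> a)" using cl by (simp add: m_assoc)
  also have "\<dots> = (x \<otimes> v) \<otimes> a \<otimes> y" unfolding ya using cl by (simp add: m_assoc)
  also have "\<dots> = q' \<otimes> v \<otimes> (x \<otimes> a) \<otimes> y" unfolding xv using cl by (simp add: m_assoc)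
  also have "\<dots> = q' \<otimes> v \<otimes> u \<otimes> a \<otimes> (x \<otimes> y)" unfolding xa using cl by (simp add: m_assoc)
  also have "\<dots> = q' \<otimes> v \<otimes> u \<otimes> (a \<otimes> c) \<otimes> (y \<otimes> x)" unfolding xy using cl by (simp add: m_assoc)
  also have "\<dots> = q' \<otimes> v \<otimes> u \<otimes> (?e \<otimes> c) \<otimes> (a \<otimes> y \<otimes> x)"
    unfolding ac using cl by (simp add: m_assoc)
  also have "?e \<otimes> c = c \<otimes> ?e" using e cl by simp
  also have "q' \<otimes> v \<otimes> u \<otimes> (c \<otimes> ?e) = q' \<otimes> v \<otimes> (c \<otimes> u) \<otimes> ?e"
    unfolding com using cl by (simp add: m_assoc)
  also have "\<dots> = q' \<otimes> (c \<otimes> v) \<otimes> u \<otimes> ?e" unfolding com(2) using cl by (simp add: m_assoc)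
  also have "\<dots> = (c \<otimes> q') \<otimes> v \<otimes> u \<otimes> ?e" unfolding com(3) using cl by (simp add: m_assoc)
  also have "\<dots> = c \<otimes> (q' \<otimes> (v \<otimes> u) \<otimes> ?e)" using cl by (simp add: m_assoc)
  finally have "c \<otimes> (q \<otimes> (u \<otimes> v)) \<otimes> (a \<otimes> y \<otimes> x)
      = c \<otimes> (q' \<otimes> (v \<otimes> u) \<otimes> ?e) \<otimes> (a \<otimes> y \<otimes> x)"
    unfolding 1 .
  then show ?thesis using cl by simp
qed

lemma commutator_mult_central_right:
  assumes "a \<in> carrier G" "q \<in> carrier G" "z \<in> center G"
  shows "commutator G a (q \<otimes> z) = commutator G a q"
proof -
  have z: "z \<in> carrier G" "z \<otimes> inv a = inv a \<otimes> z"
    using assms by (auto simp: mem_centralizer_iff)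
  have "commutator G a (q \<otimes> z) = a \<otimes> q \<otimes> (z \<otimes> inv a) \<otimes> inv z \<otimes> inv q"
    using assms(1,2) z(1) by (simp add: commutator_def word_simps)
  also have "\<dots> = commutator G a q"
    unfolding z(2) using assms(1,2) z(1) by (simp add: commutator_def word_simps)
  finally show ?thesis .
qed

text \<open>Writing the relevant quotients additively, \<open>B\<close> being centralised by
  \<open>x\<close>, \<open>y\<close>, the Jacobi identity for \<open>y, u, a\<close> gives
  \<open>[a,[y,u]] = [u,v]\<close>, the one for \<open>x, v, a\<close> gives \<open>[a,[x,v]] = [v,u]\<close>,
  and the one for \<open>x, y, a\<close> shows that \<open>[y,u]\<close> and \<open>[x,v]\<close> agree modulo the centre.\<close>
lemma commutator_square_eq_one:
  assumes car: "x \<in> carrier G" "y \<in> carrier G" "a \<in> carrier G" "B \<subseteq> carrier G"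
    and u: "u = commutator G x a" and v: "v = commutator G y a"
    and com: "\<And>b g. b \<in> B \<Longrightarrow> g \<in> {x, y, u, v} \<union> B \<Longrightarrow> g \<otimes> b = b \<otimes> g"
    and cen: "\<And>b. b \<in> B \<Longrightarrow> commutator G a b \<in> center G"
    and B: "commutator G x y \<in> B" "commutator G y u \<in> B" "commutator G x v \<in> B"
       "commutator G a u \<in> B" "commutator G a v \<in> B"
    and uv: "commutator G u v \<in> center G"
  shows "commutator G u v \<otimes> commutator G u v = \<one>"
proof -
  let ?q = "commutator G y u" and ?q' = "commutator G x v" and ?c = "commutator G x y"
  let ?m = "commutator G u v" and ?e = "commutator G a (commutator G x y)"
  have cl: "u \<in> carrier G" "v \<in> carrier G" "?q \<in> carrier G" "?q' \<in> carrier G" "?m \<in> carrier G"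
    "?e \<in> carrier G" using car u v by auto
  have Z: "subgroup (center G) G" by (rule subgroup_centralizer) simp
  have vu: "commutator G v u \<in> center G" by (rule commutator_flip_mem[OF Z cl(1,2) uv])
  have "commutator G a u \<otimes> ?q = ?q \<otimes> commutator G a u" "v \<otimes> ?q = ?q \<otimes> v"
    "y \<otimes> commutator G a u = commutator G a u \<otimes> y" "v \<otimes> commutator G a u = commutator G a u \<otimes> v"
    by (rule com; use B in simp)+
  then have 1: "commutator G a ?q \<otimes> commutator G v u = \<one>"
    by (intro commutator_exchange[OF cl(1) car(2,3) v refl refl] cen[OF B(2)] vu)
  have "commutator G a v \<otimes> ?q' = ?q' \<otimes> commutator G a v" "u \<otimes> ?q' = ?q' \<otimes> u"
    "x \<otimes> commutator G a v = commutator G a v \<otimes> x" "u \<otimes> commutator G a v = commutator G a v \<otimes> u"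
    by (rule com; use B in simp)+
  then have 2: "commutator G a ?q' \<otimes> commutator G u v = \<one>"
    by (intro commutator_exchange[OF cl(2) car(1,3) u refl refl] cen[OF B(3)] uv)
  have "?c \<otimes> u = u \<otimes> ?c" "?c \<otimes> v = v \<otimes> ?c" "?c \<otimes> ?q' = ?q' \<otimes> ?c"
    by (rule com[symmetric]; use B in simp)+
  then have "?q \<otimes> (u \<otimes> v) = ?q' \<otimes> (v \<otimes> u) \<otimes> ?e"
    by (intro commutator_jacobi[OF car(1-3) u v refl refl refl] cen[OF B(1)])
  moreover have "u \<otimes> v = ?m \<otimes> (v \<otimes> u)"
    using commutator_mult_swap[of u v] cl by (simp add: m_assoc)
  moreover have "(v \<otimes> u) \<otimes> ?e = ?e \<otimes> (v \<otimes> u)"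
    using cen[OF B(1)] cl by (simp add: mem_centralizer_iff)
  ultimately have "(?q \<otimes> ?m) \<otimes> (v \<otimes> u) = (?q' \<otimes> ?e) \<otimes> (v \<otimes> u)"
    using cl by (simp add: m_assoc)
  then have "?q \<otimes> ?m = ?q' \<otimes> ?e" using cl by simp
  then have "?q = ?q' \<otimes> (?e \<otimes> inv ?m)"
    using cl by (metis inv_closed inv_solve_right m_assoc m_closed)
  moreover have "?e \<otimes> inv ?m \<in> center G"
    using subgroup.m_closed[OF Z cen[OF B(1)] subgroup.m_inv_closed[OF Z uv]] .
  ultimately have "commutator G a ?q = commutator G a ?q'"
    using commutator_mult_central_right[OF car(3) cl(4)] by metis
  \<comment> \<open>By facts 1 and 2, \<open>[v,u]\<close> and \<open>[u,v]\<close> are the inverses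
    of \<open>[a,q]\<close> and \<open>[a,q']\<close>, which have just been shown equal. As
    \<open>[v,u]\<close> is also the inverse of \<open>[u,v]\<close>, the square is trivial.\<close>
  then have "commutator G v u = commutator G u v"
    using 1 2 cl car by (metis commutator_closed inv_equality inv_inv inv_comm)
  then show ?thesis
    using inv_commutator[OF cl(1,2)] cl by (metis r_inv)
qed

end

section \<open>Subgroups of small index\<close>

context group
begin

lemma card_subgroup_dvd:
  assumes "subgroup H G" "subgroup M G" "H \<subseteq> M"
  shows "card H dvd card M"
proof -
  have "card (rcosets\<^bsub>G\<lparr>carrier := M\<rparr>\<^esub> H) * card H = card M"
    using group.lagrange[OF subgroup_imp_group[OF assms(2)] subgroup_incl[OF assms]]
    by (simp add: order_def)
  then show ?thesis by (metis dvd_triv_right)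
qed

text \<open>By Lagrange, the index of \<open>H\<close> in \<open>L\<close> divides the prime
  \<open>p\<close>, so it is 1 or \<open>p\<close>.\<close>

lemma subgroup_between_prime_index:
  assumes "Factorial_Ring.prime (p::nat)" "finite M" "card M = p * card H"
    and "subgroup H G" "subgroup L G" "subgroup M G" "H \<subseteq> L" "L \<subseteq> M"
  shows "L = H \<or> L = M"
proof -
  have fin: "finite L" "finite H" using assms finite_subset by metis+
  obtain k where k: "card L = card H * k"
    using card_subgroup_dvd[OF assms(4,5,7)] by (auto elim: dvdE)
  have "card H > 0"
    using fin subgroup.one_closed[OF assms(4)] card_gt_0_iff by blast
  then have "k dvd p"
    using card_subgroup_dvd[OF assms(5,6,8)] assms(3) k by (simp add: mult.commute)
  then have "k = 1 \<or> k = p" using assms(1) by (auto simp: prime_nat_iff)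
  then show ?thesis
    using k assms(2,3,7,8) fin by (metis card_subset_eq mult.commute mult_1)
qed

lemma subgroup_Int_centralizer:
  "subgroup H G \<Longrightarrow> S \<subseteq> carrier G \<Longrightarrow> subgroup (H \<inter> centralizer G S) G"
  by (intro subgroups_Inter_pair subgroup_centralizer)

text \<open>For a noncentral \<open>x\<close> in \<open>A\<close>, the centralizer of
  \<open>x\<close> in \<open>A\<close> contains the centre and also \<open>x\<close>. If the centre
  had prime index, this centralizer would be all of \<open>A\<close>, making \<open>x\<close>
  central.\<close>

lemma center_index_not_prime:
  assumes "Factorial_Ring.prime (p::nat)" "finite A" "subgroup A G"
  shows "card A \<noteq> p * card (A \<inter> centralizer G A)"
proof
  let ?Z = "A \<inter> centralizer G A"
  assume eq: "card A = p * card ?Z"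
  have sA: "A \<subseteq> carrier G" by (rule subgroup.subset) fact
  have Z: "subgroup ?Z G" by (intro subgroup_Int_centralizer assms sA)
  then have "card ?Z > 0"
    using assms(2) subgroup.one_closed[OF Z] card_gt_0_iff by blast
  then have "card ?Z \<noteq> card A"
    unfolding eq using prime_gt_1_nat[OF assms(1)] by (metis mult_1 mult_cancel2 nat_neq_iff)
  then have "?Z \<noteq> A" by metis
  then obtain x where x: "x \<in> A" "x \<notin> ?Z" by blast
  let ?L = "A \<inter> centralizer G {x}"
  have "?L = ?Z \<or> ?L = A"
    by (rule subgroup_between_prime_index[OF assms(1,2) eq Z _ assms(3)])
       (use x sA in \<open>auto intro!: subgroup_Int_centralizer assms simp: mem_centralizer_iff subset_iff\<close>)
  moreover have "x \<in> ?L" using x sA by (auto simp: mem_centralizer_iff)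
  ultimately have "A \<subseteq> centralizer G {x}" using x by auto
  then have "a \<otimes> x = x \<otimes> a" if "a \<in> A" for a using that by (auto simp: mem_centralizer_iff)
  then have "x \<in> ?Z" using x sA by (auto simp: mem_centralizer_iff)
  with x show False by simp
qed

lemma derived_trivial_iff:
  assumes "A \<subseteq> carrier G"
  shows "derived G A = {\<one>} \<longleftrightarrow> A \<subseteq> centralizer G A"
proof -
  have "derived G A = {\<one>} \<longleftrightarrow> derived G A \<subseteq> {\<one>}"
    using subgroup.one_closed[OF derived_is_subgroup[OF assms]] by blast
  also have "\<dots> \<longleftrightarrow> (\<forall>x\<in>A. \<forall>y\<in>A. x \<otimes> y = y \<otimes> x)"
    unfolding derived_subset_iff[OF triv_subgroup]
    using assms by (intro ball_cong refl) (simp add: commutator_eq_one_iff subset_iff)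
  finally show ?thesis using assms by (auto simp: centralizer_def)
qed

text \<open>The centre of \<open>A\<close> contains \<open>B\<close>, so its index divides
  \<open>p\<^sup>2\<close>. Index 1 would make \<open>A\<close> abelian and index \<open>p\<close>
  is excluded by \<open>center_index_not_prime\<close>; index \<open>p\<^sup>2\<close> leaves only
  \<open>B\<close>.\<close>

lemma centralizer_eq_of_index_prime_square:
  assumes p: "Factorial_Ring.prime (p::nat)" and "finite A" and A: "subgroup A G" and B: "subgroup B G"
    and "B \<subseteq> A" "B \<subseteq> centralizer G A" and card: "card A = p ^ 2 * card B"
    and "derived G A \<noteq> {\<one>}"
  shows "A \<inter> centralizer G A = B"
proof -
  let ?Z = "A \<inter> centralizer G A"
  have sA: "A \<subseteq> carrier G" by (rule subgroup.subset) fact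
  have Z: "subgroup ?Z G" by (intro subgroup_Int_centralizer A sA)
  obtain k where k: "card ?Z = card B * k"
    using card_subgroup_dvd[OF B Z] assms(5,6) by (meson dvdE le_inf_iff)
  obtain l where l: "card A = card ?Z * l"
    using card_subgroup_dvd[OF Z A] by (meson dvdE inf_le1)
  have "card B > 0"
    using assms(2,5) subgroup.one_closed[OF B] card_gt_0_iff finite_subset by blast
  then have "k * l = p ^ 2" using k l card by simp
  then have "l dvd p ^ 2" by (metis dvd_triv_right)
  then obtain i where "i \<le> 2" "l = p ^ i" using divides_primepow_nat[OF p] by blast
  then consider "l = 1" | "l = p" | "l = p ^ 2"
    by (auto simp: le_Suc_eq numeral_2_eq_2)
  then show ?thesis
  proof cases
    case 1
    then have "?Z = A" using l assms(2) by (intro card_subset_eq) auto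
    then show ?thesis using assms(8) derived_trivial_iff[OF sA] by blast
  next
    case 2
    then show ?thesis using center_index_not_prime[OF p assms(2) A] l by (simp add: mult.commute)
  next
    case 3
    with \<open>k * l = p ^ 2\<close> have "k = 1" using p by simp
    then show ?thesis
      using k assms(2,5,6) by (intro card_subset_eq[symmetric]) auto
  qed
qed

section \<open>Generating the derived subgroup modulo a normal subgroup\<close>

text \<open>This set is the preimage of the centralizer of the coset of \<open>h\<close> in
  \<open>G/E\<close>. It allows commutator conditions to be checked on generators only.\<close>

lemma subgroup_commutator_preimage:
  assumes "E \<lhd> G" "h \<in> carrier G"
  shows "subgroup {g \<in> carrier G. commutator G g h \<in> E} G"
proof -
  interpret E: normal E G by fact
  show ?thesis
  proof
    fix x y assume "x \<in> {g \<in> carrier G. commutator G g h \<in> E}" "y \<in> {g \<in> carrier G. commutator G g h \<in> E}"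
    then show "x \<otimes> y \<in> {g \<in> carrier G. commutator G g h \<in> E}"
      using assms(2) E.inv_op_closed2 by (auto simp: commutator_mult_left)
  next
    fix x assume "x \<in> {g \<in> carrier G. commutator G g h \<in> E}"
    then show "inv x \<in> {g \<in> carrier G. commutator G g h \<in> E}"
      using assms(2) E.inv_op_closed2[of "inv x" "inv (commutator G x h)"]
      by (auto simp: commutator_inv_left)
  qed (use assms(2) in \<open>auto simp: commutator_def\<close>)
qed

text \<open>The map \<open>g \<mapsto> [g,b]\<close> is a homomorphism onto the central subgroup \<open>C\<close> of
  prime order, with kernel the centralizer of \<open>b\<close>.\<close>
lemma generated_by_centralizer:
  assumes p: "Factorial_Ring.prime (p::nat)" and C: "subgroup C G" "card C = p" "C \<subseteq> center G"
    and b: "b \<in> carrier G" and bC: "\<And>g. g \<in> carrier G \<Longrightarrow> commutator G g b \<in> C"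
    and a: "a \<in> carrier G" "commutator G a b \<noteq> \<one>"
    and L: "subgroup L G" "centralizer G {b} \<subseteq> L" "a \<in> L"
  shows "L = carrier G"
proof -
  let ?f = "\<lambda>g. commutator G g b"
  have hom: "?f (x \<otimes> y) = ?f x \<otimes> ?f y" if "x \<in> carrier G" "y \<in> carrier G" for x y
  proof -
    have "?f x \<in> center G" "?f y \<in> center G" using bC that C by auto
    then have c: "x \<otimes> ?f y = ?f y \<otimes> x" "?f y \<otimes> ?f x = ?f x \<otimes> ?f y"
      using that unfolding mem_centralizer_iff by metis+
    have "?f (x \<otimes> y) = x \<otimes> ?f y \<otimes> inv x \<otimes> ?f x" using that b by (simp add: commutator_mult_left)
    also have "\<dots> = ?f x \<otimes> ?f y" unfolding c(1) using c(2) that b by (simp add: m_assoc)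
    finally show ?thesis .
  qed
  interpret f: group_hom G G ?f
    by unfold_locales (use hom b in \<open>auto simp: hom_def\<close>)
  have fL: "subgroup (?f ` L) G" by (rule f.subgroup_img_is_subgroup[OF L(1)])
  have finC: "finite C" using C(2) p by (metis card.infinite not_prime_0)
  have sub: "?f ` L \<subseteq> C" using bC subgroup.subset[OF L(1)] by auto
  \<comment> \<open>The image of \<open>L\<close> contains \<open>[a,b] \<noteq> 1\<close>, so it is
    all of \<open>C\<close>. Since \<open>L\<close> also contains the kernel, it is the whole
    group.\<close>
  have "?f ` L = {\<one>} \<or> ?f ` L = C"
    by (rule subgroup_between_prime_index[OF p finC _ triv_subgroup fL C(1) _ sub])
       (use C(2) subgroup.one_closed[OF fL] in auto)
  then have im: "?f ` L = C" using L(3) a(2) by blast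
  have "g \<in> L" if g: "g \<in> carrier G" for g
  proof -
    obtain l where l: "l \<in> L" "?f g = ?f l" using im bC[OF g] by blast
    then have lc: "l \<in> carrier G" using subgroup.subset[OF L(1)] by blast
    then have "?f (g \<otimes> inv l) = \<one>" using g l(2) b by simp
    then have "(g \<otimes> inv l) \<otimes> b = b \<otimes> (g \<otimes> inv l)"
      using commutator_eq_one_iff[of "g \<otimes> inv l" b] g lc b by blast
    then have "g \<otimes> inv l \<in> L"
      using g lc L(2) by (auto simp: centralizer_def)
    then have "g \<otimes> inv l \<otimes> l \<in> L" using l(1) subgroup.m_closed[OF L(1)] by blast
    then show ?thesis using g lc by (simp add: m_assoc)
  qed
  then show ?thesis using subgroup.subset[OF L(1)] by blast
qed

text \<open>For fixed \<open>h\<close>, the elements \<open>g\<close> with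
  \<open>[g,h] \<in> E\<close> form a subgroup, which is everything once it contains
  \<open>K\<close>. This is applied first with \<open>h \<in> K\<close>; after swapping the
  arguments it applies to arbitrary \<open>h\<close>.\<close>

lemma commutators_generated:
  assumes E: "E \<lhd> G" and K: "K \<subseteq> carrier G" "\<And>x y. x \<in> K \<Longrightarrow> y \<in> K \<Longrightarrow> commutator G x y \<in> E"
    and gen: "\<And>L. subgroup L G \<Longrightarrow> K \<subseteq> L \<Longrightarrow> L = carrier G"
  shows "derived G (carrier G) \<subseteq> E"
proof -
  have sE: "subgroup E G" using E by (rule normal_imp_subgroup)
  have *: "carrier G = {g \<in> carrier G. commutator G g h \<in> E}"
    if "h \<in> carrier G" "\<And>k. k \<in> K \<Longrightarrow> commutator G k h \<in> E" for h
    using gen[OF subgroup_commutator_preimage[OF E that(1)]] that(2) K(1) by blast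
  have 1: "commutator G g k \<in> E" if "g \<in> carrier G" "k \<in> K" for g k
    using *[of k] that K by blast
  have "commutator G k g \<in> E" if "g \<in> carrier G" "k \<in> K" for g k
    using commutator_flip_mem[OF sE that(1) _ 1[OF that]] that K by blast
  then have "commutator G g h \<in> E" if "g \<in> carrier G" "h \<in> carrier G" for g h
    using *[of h] that by blast
  then show ?thesis unfolding derived_subset_iff[OF sE] by blast
qed

text \<open>The commutators \<open>[k,a]\<close> with \<open>k\<close> centralising \<open>b\<close> generate the derived subgroup
  modulo its centre \<open>B\<close>, so two of them fail to commute.\<close>
lemma derived_abelian_of_small_factors:
  assumes fin: "finite (carrier G)" and p: "Factorial_Ring.prime (p::nat)" "p \<noteq> 2"
    and B: "subgroup B G" and C: "subgroup C G"
    and incl: "C \<subseteq> B" "B \<subseteq> derived G (carrier G)" "C \<subseteq> center G"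
    and card: "card (derived G (carrier G)) = p ^ 2 * card B" "card B = p * card C" "card C = p"
    and comB: "\<And>g w. g \<in> carrier G \<Longrightarrow> w \<in> derived G (carrier G) \<Longrightarrow> commutator G g w \<in> B"
    and comC: "\<And>g b. g \<in> carrier G \<Longrightarrow> b \<in> B \<Longrightarrow> commutator G g b \<in> C"
    and comA: "derived G (derived G (carrier G)) \<subseteq> C"
    and nontriv: "\<not> B \<subseteq> center G"
  shows "derived G (derived G (carrier G)) = {\<one>}"
proof (rule ccontr)
  let ?A = "derived G (carrier G)"
  assume nonabelian: "derived G ?A \<noteq> {\<one>}"
  have A: "?A \<lhd> G" by (rule derived_self_is_normal)
  have sA: "subgroup ?A G" "?A \<subseteq> carrier G" using A normal_imp_subgroup subgroup.subset by blast+
  have cB: "B \<subseteq> carrier G" using incl sA by blast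
  \<comment> \<open>All \<open>[g,b]\<close> lie in the central subgroup \<open>C\<close>, so the
    derived subgroup centralizes \<open>b\<close>.\<close>
  have AB: "w \<otimes> b = b \<otimes> w" if "w \<in> ?A" "b \<in> B" for w b
  proof -
    have "?A \<subseteq> centralizer G {b}"
      using that cB comC incl by (intro derived_commutes) auto
    then show ?thesis using that by (auto simp: centralizer_def)
  qed
  \<comment> \<open>\<open>B\<close> is central of index \<open>p\<^sup>2\<close> in the nonabelian
    \<open>?A\<close>, so it is the full centre of \<open>?A\<close>. From here on, membership in
    \<open>B\<close> is proved by checking commutation with \<open>?A\<close>.\<close>
  have "?A \<inter> centralizer G ?A = B"
  proof (rule centralizer_eq_of_index_prime_square[OF p(1) _ sA(1) B incl(2) _ card(1) nonabelian])
    show "finite ?A" using fin sA finite_subset by blast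
    have "b \<otimes> w = w \<otimes> b" if "b \<in> B" "w \<in> ?A" for b w using AB that by metis
    then show "B \<subseteq> centralizer G ?A" using cB by (auto simp: centralizer_def)
  qed
  then have BI: "d \<in> B" if "d \<in> ?A" "\<And>w. w \<in> ?A \<Longrightarrow> d \<otimes> w = w \<otimes> d" for d
    using that sA by (auto simp: centralizer_def)
  obtain b a where b: "b \<in> B" and a: "a \<in> carrier G" and ab: "commutator G a b \<noteq> \<one>"
  proof -
    obtain b where b: "b \<in> B" "b \<notin> center G" using nontriv by blast
    then obtain a where "a \<in> carrier G" "b \<otimes> a \<noteq> a \<otimes> b" using cB by (auto simp: centralizer_def)
    then show ?thesis using that[OF b(1), of a] commutator_eq_one_iff[of a b] b cB by auto
  qed
  have bc: "b \<in> carrier G" using b cB by blast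
  \<comment> \<open>Centralizing the single element \<open>b\<close> makes \<open>K\<close> the
    kernel of \<open>g \<mapsto> [g,b]\<close>; that \<open>K\<close> centralizes all of
    \<open>B\<close> is \<open>KB\<close>.\<close>
  define K where "K = centralizer G {b}"
  have K: "subgroup K G" "K \<subseteq> carrier G"
    unfolding K_def using subgroup_centralizer[of "{b}"] bc subgroup.subset by blast+
  have finB: "finite B" using fin cB finite_subset by blast
  \<comment> \<open>The centralizer of \<open>k\<close> in \<open>B\<close> contains
    \<open>C\<close>, which has prime index in \<open>B\<close>, and also \<open>b\<close>, which
    lies outside \<open>C\<close>; hence it is \<open>B\<close>.\<close>
  have KB: "k \<otimes> d = d \<otimes> k" if k: "k \<in> K" and d: "d \<in> B" for k d
  proof -
    let ?L = "B \<inter> centralizer G {k}"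
    have kc: "k \<in> carrier G" using k K by blast
    have L: "subgroup ?L G" using kc B by (intro subgroup_Int_centralizer) auto
    have CL: "C \<subseteq> ?L" using incl kc by (auto simp: centralizer_def)
    have "?L = C \<or> ?L = B"
      by (rule subgroup_between_prime_index[OF p(1) finB card(2) C L B CL]) auto
    moreover have "b \<in> ?L" using b k bc unfolding K_def centralizer_def by auto
    moreover have "b \<notin> C"
    proof
      assume "b \<in> C"
      then have "a \<otimes> b = b \<otimes> a" using incl(3) a unfolding mem_centralizer_iff subset_iff by metis
      then show False using ab commutator_eq_one_iff[OF a bc] by blast
    qed
    ultimately have "d \<in> centralizer G {k}" using d by blast
    then show ?thesis by (auto simp: centralizer_def)
  qed
  \<comment> \<open>\<open>commutator_commutes\<close> with \<open>B\<close> as \<open>S\<close>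
    shows that \<open>[k,l]\<close> centralizes \<open>?A\<close>, because \<open>[k,w]\<close> and
    \<open>[l,w]\<close> lie in \<open>B\<close> and \<open>k\<close>, \<open>l\<close> centralize
    \<open>B\<close>.\<close>
  have KK: "commutator G k l \<in> B" if kl: "k \<in> K" "l \<in> K" for k l
  proof (rule BI)
    have klc: "k \<in> carrier G" "l \<in> carrier G" using kl K by auto
    then show "commutator G k l \<in> ?A" by (rule commutator_in_derived)
    fix w assume w: "w \<in> ?A"
    show "commutator G k l \<otimes> w = w \<otimes> commutator G k l"
      by (rule commutator_commutes[OF klc _ cB comB[OF klc(1) w] comB[OF klc(2) w]])
         (use w sA KB kl AB incl in blast)+
  qed
  \<comment> \<open>Since \<open>[G,?A] \<subseteq> B\<close>, every subgroup between
    \<open>B\<close> and \<open>?A\<close> is normal. As \<open>K\<close> and \<open>a\<close>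
    generate \<open>G\<close> and \<open>[K,K] \<subseteq> B\<close>, only the commutators
    \<open>[k,a]\<close> remain to be checked.\<close>
  have gen: "?A \<subseteq> E" if E: "subgroup E G" "B \<subseteq> E" "E \<subseteq> ?A" "\<And>k. k \<in> K \<Longrightarrow> commutator G k a \<in> E" for E
  proof (rule commutators_generated[of _ "insert a K"])
    show "E \<lhd> G"
    proof (rule normal_invI[OF E(1)])
      fix x h assume x: "x \<in> carrier G" and h: "h \<in> E"
      then have hc: "h \<in> carrier G" using E(3) sA(2) by blast
      have "commutator G x h \<otimes> h \<in> E"
        using comB[OF x, of h] E h subgroup.m_closed[OF E(1)] by blast
      then show "x \<otimes> h \<otimes> inv x \<in> E" using x hc by (simp add: commutator_def m_assoc)
    qed
    show "insert a K \<subseteq> carrier G" using a K by blast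
    show "L = carrier G" if "subgroup L G" "insert a K \<subseteq> L" for L
      using that unfolding K_def
      by (intro generated_by_centralizer[OF p(1) C card(3) incl(3) bc comC[OF _ b] a ab]) auto
    have "commutator G a a = \<one>" using commutator_eq_one_iff[OF a a] by blast
    moreover have "commutator G a k \<in> E" if "k \<in> K" for k
      using commutator_flip_mem[OF E(1) _ a E(4)[OF that]] that K by blast
    ultimately show "commutator G x y \<in> E" if "x \<in> insert a K" "y \<in> insert a K" for x y
      using that E KK subgroup.one_closed[OF E(1)] by auto
  qed
  have KA: "commutator G k a \<in> ?A" if "k \<in> K" for k
    using that K a by (intro commutator_in_derived) auto
  \<comment> \<open>If every \<open>[k,a]\<close> were in \<open>B\<close>, then
    \<open>?A = B\<close> would be abelian.\<close>
  obtain x where x: "x \<in> K" "commutator G x a \<notin> B"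
  proof -
    have "?A \<noteq> B"
      using nonabelian AB derived_trivial_iff[OF sA(2)] sA(2)
      unfolding centralizer_def by blast
    then show ?thesis using that gen[OF B _ incl(2)] incl(2) by blast
  qed
  define u where "u = commutator G x a"
  have u: "u \<in> ?A" "u \<in> carrier G" using KA[OF x(1)] sA unfolding u_def by auto
  \<comment> \<open>As \<open>u\<close> is outside the centre \<open>B\<close>, its centralizer in
    \<open>?A\<close> is a proper subgroup containing \<open>B\<close>, so by \<open>gen\<close> it
    misses some \<open>[y,a]\<close>.\<close>
  obtain y where y: "y \<in> K" "commutator G y a \<notin> centralizer G {u}"
  proof -
    let ?E = "?A \<inter> centralizer G {u}"
    have "\<not> ?A \<subseteq> ?E"
    proof
      assume "?A \<subseteq> ?E"
      then have "u \<otimes> w = w \<otimes> u" if "w \<in> ?A" for w using that unfolding centralizer_def by auto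
      then show False using BI[OF u(1)] x(2) unfolding u_def by blast
    qed
    moreover have "subgroup ?E G" using sA u by (intro subgroup_Int_centralizer) auto
    moreover have "B \<subseteq> ?E"
    proof -
      have "d \<otimes> u = u \<otimes> d" if "d \<in> B" for d using AB[OF u(1) that] by simp
      then show ?thesis using incl(2) cB by (auto simp: centralizer_def)
    qed
    ultimately show ?thesis using gen[of ?E] that KA by blast
  qed
  define v where "v = commutator G y a"
  have v: "v \<in> ?A" "v \<in> carrier G" using KA[OF y(1)] sA unfolding v_def by auto
  have xyc: "x \<in> carrier G" "y \<in> carrier G" using x y K by auto
  let ?m = "commutator G u v"
  have mC: "?m \<in> C" using comA commutator_in_derived[OF u(1) v(1)] by blast
  have mc: "?m \<in> carrier G" using u v by blast
  have "?m \<otimes> ?m = \<one>"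
  proof (rule commutator_square_eq_one[OF xyc a cB u_def v_def])
    fix d g assume d: "d \<in> B" and "g \<in> {x, y, u, v} \<union> B"
    then consider "g \<in> K" | "g \<in> ?A" using x y u v incl(2) by auto
    then show "g \<otimes> d = d \<otimes> g" using d KB AB by cases auto
  qed (use comB comC incl KK x(1) y(1) u v xyc a mC in auto)
  \<comment> \<open>The order of \<open>?m\<close> divides 2 and, because \<open>?m \<in> C\<close>,
    also the odd prime \<open>p\<close>. So \<open>u\<close> and \<open>v\<close> commute, against
    the choice of \<open>y\<close>.\<close>
  then have "?m [^] (2::nat) = \<one>" using mc by (simp add: numeral_2_eq_2)
  then have "ord ?m dvd 2" using mc pow_eq_id by blast
  moreover have "ord ?m dvd p"
  proof -
    interpret GC: group "G\<lparr>carrier := C\<rparr>" by (rule subgroup_imp_group[OF C])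
    have "?m [^]\<^bsub>G\<lparr>carrier := C\<rparr>\<^esub> p = \<one>"
      using GC.pow_order_eq_1[of ?m] mC card(3) by (simp add: order_def)
    then have "?m [^] p = \<one>" by (simp add: nat_pow_consistent[symmetric])
    then show ?thesis using mc pow_eq_id by blast
  qed
  moreover have "coprime 2 p"
    using p primes_coprime[of 2 p] by (simp add: two_is_prime_nat)
  ultimately have "ord ?m = 1" using coprime_common_divisor_nat by blast
  then have "?m = \<one>" using mc ord_eq_1 by blast
  then have "u \<otimes> v = v \<otimes> u" using commutator_eq_one_iff u v by blast
  then have "v \<in> centralizer G {u}" using v unfolding centralizer_def by auto
  then show False using y(2) unfolding v_def by blast
qed

end

section \<open>The lower central series and its quotients\<close>

context group
begin

lemma commutator_conj:
  assumes "g \<in> carrier G" "x \<in> carrier G" "y \<in> carrier G"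
  shows "g \<otimes> commutator G x y \<otimes> inv g
    = commutator G (g \<otimes> x \<otimes> inv g) (g \<otimes> y \<otimes> inv g)"
  using assms by (simp add: commutator_def word_simps)

lemma normal_commutator_subgroup:
  assumes "N \<lhd> G" "K \<lhd> G" shows "commutator_subgroup G N K \<lhd> G"
proof -
  interpret N: normal N G by fact
  interpret K: normal K G by fact
  show ?thesis
    unfolding commutator_subgroup_eq
  proof (rule normal_generateI)
    show "{commutator G h k |h k. h \<in> N \<and> k \<in> K} \<subseteq> carrier G" by auto
    fix x g assume "x \<in> {commutator G h k |h k. h \<in> N \<and> k \<in> K}" and g: "g \<in> carrier G"
    then obtain h k where "x = commutator G h k" "h \<in> N" "k \<in> K" by blast
    moreover from this have "g \<otimes> commutator G h k \<otimes> inv g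
        = commutator G (g \<otimes> h \<otimes> inv g) (g \<otimes> k \<otimes> inv g)"
      using g by (intro commutator_conj) auto
    moreover have "g \<otimes> h \<otimes> inv g \<in> N" "g \<otimes> k \<otimes> inv g \<in> K"
      using N.inv_op_closed2[OF g] K.inv_op_closed2[OF g] \<open>h \<in> N\<close> \<open>k \<in> K\<close> by blast+
    ultimately show "g \<otimes> x \<otimes> inv g \<in> {commutator G h k |h k. h \<in> N \<and> k \<in> K}"
      by blast
  qed
qed

lemma commutator_subgroup_subset_iff:
  assumes "subgroup M G"
  shows "commutator_subgroup G H K \<subseteq> M \<longleftrightarrow> (\<forall>h\<in>H. \<forall>k\<in>K. commutator G h k \<in> M)"
proof
  assume "\<forall>h\<in>H. \<forall>k\<in>K. commutator G h k \<in> M"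
  then show "commutator_subgroup G H K \<subseteq> M"
    unfolding commutator_subgroup_eq by (intro generate_subgroup_incl[OF _ assms]) blast
qed (auto simp: commutator_subgroup_eq intro: generate.incl)

lemma lower_central_Suc:
  "n > 0 \<Longrightarrow> lower_central G (Suc n) = commutator_subgroup G (lower_central G n) (carrier G)"
  by (cases n) auto

lemma lower_central_numeral:
  "lower_central G 3 = commutator_subgroup G (lower_central G 2) (carrier G)"
  "lower_central G 4 = commutator_subgroup G (lower_central G 3) (carrier G)"
  "lower_central G 5 = commutator_subgroup G (lower_central G 4) (carrier G)"
  by (simp_all add: eval_nat_numeral)

lemma lower_central_normal: "lower_central G n \<lhd> G"
proof (induction n)
  case (Suc n)
  then show ?case
    by (cases n) (auto simp: normal_self intro: normal_commutator_subgroup)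
qed (simp add: normal_self)

lemma lower_central_subgroup: "subgroup (lower_central G n) G"
  using lower_central_normal by (rule normal_imp_subgroup)

lemma lower_central_commutator:
  assumes "n > 0" "w \<in> lower_central G n" "g \<in> carrier G"
  shows "commutator G w g \<in> lower_central G (Suc n)" "commutator G g w \<in> lower_central G (Suc n)"
proof -
  show 1: "commutator G w g \<in> lower_central G (Suc n)"
    using assms unfolding lower_central_Suc[OF assms(1)] commutator_subgroup_eq
    by (blast intro: generate.incl)
  have "w \<in> carrier G" using assms(2) subgroup.subset[OF lower_central_subgroup] by blast
  then show "commutator G g w \<in> lower_central G (Suc n)"
    using commutator_flip_mem[OF lower_central_subgroup _ assms(3) 1] by blast
qed

lemma lower_central_Suc_subset: "lower_central G (Suc n) \<subseteq> lower_central G n"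
proof (cases "n = 0")
  case False
  then show ?thesis
    using normal_commutator_left[OF lower_central_normal]
    by (simp add: lower_central_Suc commutator_subgroup_subset_iff lower_central_subgroup)
qed simp

lemma lower_central_Suc_trivial:
  assumes "n > 0" "lower_central G (Suc n) = {\<one>}"
  shows "lower_central G n \<subseteq> center G"
proof
  fix w assume w: "w \<in> lower_central G n"
  then have wc: "w \<in> carrier G" using subgroup.subset[OF lower_central_subgroup] by blast
  have "w \<otimes> g = g \<otimes> w" if g: "g \<in> carrier G" for g
    using lower_central_commutator(1)[OF assms(1) w g] assms(2) commutator_eq_one_iff[OF wc g] by blast
  then show "w \<in> center G" using wc by (simp add: centralizer_def)
qed

text \<open>This is the inclusion of \<open>[G\<^sub>n, G\<^sub>2]\<close> in
  \<open>G\<^sub>n\<^sub>+\<^sub>2\<close>, stated for groups in which the latter is trivial: then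
  every \<open>[g,w]\<close> lies in the central term \<open>G\<^sub>n\<^sub>+\<^sub>1\<close> and
  \<open>derived_commutes\<close> applies.\<close>

lemma lower_central_centralizes_derived:
  assumes "n > 0" "lower_central G (Suc (Suc n)) = {\<one>}"
  shows "lower_central G n \<subseteq> centralizer G (derived G (carrier G))"
proof
  fix w assume w: "w \<in> lower_central G n"
  then have wc: "w \<in> carrier G" using subgroup.subset[OF lower_central_subgroup] by blast
  have "derived G (carrier G) \<subseteq> centralizer G {w}"
  proof (rule derived_commutes[OF wc])
    fix g assume "g \<in> carrier G"
    then show "commutator G g w \<in> center G"
      using lower_central_commutator(2)[OF assms(1) w] lower_central_Suc_trivial[of "Suc n"] assms(2)
      by blast
  qed
  then have "d \<otimes> w = w \<otimes> d" if "d \<in> derived G (carrier G)" for d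
    using that by (auto simp: mem_centralizer_iff)
  then show "w \<in> centralizer G (derived G (carrier G))"
    unfolding mem_centralizer_iff using wc by metis
qed

end

section \<open>Images under homomorphisms and quotient maps\<close>

context group_hom
begin

lemma commutator_img:
  "x \<in> carrier G \<Longrightarrow> y \<in> carrier G \<Longrightarrow> h (commutator G x y) = commutator H (h x) (h y)"
  by (simp add: commutator_def)

lemma commutator_subgroup_img:
  assumes "S \<subseteq> carrier G" "T \<subseteq> carrier G"
  shows "commutator_subgroup H (h ` S) (h ` T) = h ` commutator_subgroup G S T"
proof -
  let ?C = "{commutator G x y |x y. x \<in> S \<and> y \<in> T}"
  have "h ` ?C = {h (commutator G x y) |x y. x \<in> S \<and> y \<in> T}"
    by blast
  also have "\<dots> = {commutator H (h x) (h y) |x y. x \<in> S \<and> y \<in> T}"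
    using assms commutator_img by (intro Collect_cong) (metis subsetD)
  also have "\<dots> = {commutator H x y |x y. x \<in> h ` S \<and> y \<in> h ` T}"
    by blast
  finally have "{commutator H x y |x y. x \<in> h ` S \<and> y \<in> h ` T} = h ` ?C" ..
  moreover have "?C \<subseteq> carrier G" using assms by auto
  ultimately show ?thesis
    unfolding commutator_subgroup_eq by (simp only: generate_img)
qed

text \<open>Surjectivity enters at every stage, because each term takes commutators with the whole
  group.\<close>

lemma lower_central_img:
  assumes "h ` carrier G = carrier H"
  shows "lower_central H n = h ` lower_central G n"
proof (induction n)
  case (Suc n)
  then show ?case
    using commutator_subgroup_img[OF subgroup.subset[OF G.lower_central_subgroup], of "carrier G" n] assms
    by (cases n) auto
qed (simp add: assms)

end

context normal
begin

lemma proj_group_hom: "group_hom G (G Mod H) (\<lambda>a. H #> a)"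
  using factorgroup_is_group r_coset_hom_Mod is_group
  by (auto intro!: group_hom.intro simp: group_hom_axioms_def)

lemma proj_surj: "(\<lambda>a. H #> a) ` carrier G = carrier (G Mod H)"
  by (simp add: carrier_FactGroup)

lemma proj_eq_one_iff: "x \<in> carrier G \<Longrightarrow> H #> x = \<one>\<^bsub>G Mod H\<^esub> \<longleftrightarrow> x \<in> H"
  using coset_join1[OF _ _ subgroup_axioms] rcos_const[OF is_group] by auto

lemma proj_image_eq_one_iff:
  assumes "subgroup S G"
  shows "(\<lambda>a. H #> a) ` S = {\<one>\<^bsub>G Mod H\<^esub>} \<longleftrightarrow> S \<subseteq> H"
proof -
  have "(\<lambda>a. H #> a) ` S = {\<one>\<^bsub>G Mod H\<^esub>} \<longleftrightarrow> (\<forall>x\<in>S. H #> x = \<one>\<^bsub>G Mod H\<^esub>)"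
    using subgroup.one_closed[OF assms] by (auto simp: image_def)
  also have "\<dots> \<longleftrightarrow> S \<subseteq> H"
    using proj_eq_one_iff subgroup.mem_carrier[OF assms] by blast
  finally show ?thesis .
qed

text \<open>The image of \<open>S\<close> consists of the cosets of \<open>H\<close> inside
  \<open>S\<close>, so this is Lagrange's theorem in \<open>S\<close>.\<close>

lemma card_proj_image:
  assumes "subgroup S G" "H \<subseteq> S"
  shows "card ((\<lambda>a. H #> a) ` S) * card H = card S"
proof -
  have "(\<lambda>a. H #> a) ` S = rcosets\<^bsub>G\<lparr>carrier := S\<rparr>\<^esub> H"
    by (auto simp: RCOSETS_def r_coset_def)
  then show ?thesis
    using group.lagrange[OF subgroup_imp_group[OF assms(1)] subgroup_incl[OF subgroup_axioms assms]]
    by (simp add: order_def)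
qed

lemma proj_lower_central: "lower_central (G Mod H) n = (\<lambda>a. H #> a) ` lower_central G n"
  by (rule group_hom.lower_central_img[OF proj_group_hom proj_surj])

lemma proj_derived:
  "S \<subseteq> carrier G \<Longrightarrow> derived (G Mod H) ((\<lambda>a. H #> a) ` S) = (\<lambda>a. H #> a) ` derived G S"
  by (rule group_hom.derived_img[OF proj_group_hom])

end

section \<open>Finite p-groups\<close>

context group
begin

text \<open>The class equation: with a trivial centre, \<open>{\<one>}\<close> is the only conjugacy
  class of size not divisible by \<open>p\<close>, so \<open>p ^ n\<close> would be 1 modulo
  \<open>p\<close>.\<close>

lemma p_group_center_nontrivial:
  assumes p: "Factorial_Ring.prime (p::nat)" and fin: "finite (carrier G)"
    and ord: "order G = p ^ n" "n > 0"
  shows "center G \<noteq> {\<one>}"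
proof
  assume Z: "center G = {\<one>}"
  define \<phi> where "\<phi> = (\<lambda>g. \<lambda>h\<in>carrier G. g \<otimes> h \<otimes> inv g)"
  interpret act: group_action G "carrier G" \<phi> unfolding \<phi>_def by (rule action_by_conjugation)
  let ?O = "orbits G (carrier G) \<phi>"
  have cover: "\<Union> ?O = carrier G" by (rule act.orbits_coverture)
  then have finO: "finite ?O" using fin by (intro finite_UnionD) simp
  have one: "{\<one>} \<in> ?O"
  proof -
    have "orbit G \<phi> \<one> = {\<one>}" by (auto simp: orbit_def \<phi>_def intro!: exI[of _ \<one>])
    then show ?thesis by (force simp: orbits_def)
  qed
  \<comment> \<open>By the orbit-stabilizer theorem a class has \<open>p\<close>-power size. Size 1
    would make its element central, hence trivial, and that class is excluded.\<close>
  have dvd: "p dvd card Y" if Y: "Y \<in> ?O - {{\<one>}}" for Y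
  proof -
    obtain x where x: "x \<in> carrier G" "Y = orbit G \<phi> x" using Y by (auto simp: orbits_def)
    have xY: "x \<in> Y" using act.orbit_refl x by blast
    have "card Y dvd p ^ n"
      using act.orbit_stabilizer_theorem[OF x(1)] x(2) ord(1) by (metis dvd_triv_left)
    then obtain i where i: "card Y = p ^ i" using divides_primepow_nat[OF p] by blast
    have "i \<noteq> 0"
    proof
      assume "i = 0"
      then have Xx: "Y = {x}" using i xY by (metis card_1_singletonE power_0 singletonD)
      have "g \<otimes> x = x \<otimes> g" if g: "g \<in> carrier G" for g
      proof -
        have "g \<otimes> x \<otimes> inv g \<in> Y" using x g by (force simp: orbit_def \<phi>_def)
        then have "g \<otimes> x \<otimes> inv g = x" using Xx by blast
        then show ?thesis using g x(1) inv_solve_right' by blast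
      qed
      then have "x \<in> center G" unfolding mem_centralizer_iff using x(1) by metis
      then have "x = \<one>" unfolding Z by simp
      then show False using Y Xx by simp
    qed
    then show ?thesis using i by simp
  qed
  have "p ^ n = (\<Sum>Y\<in>?O. card Y)"
    using act.disjoint_sum[OF fin, of "\<lambda>_. 1::nat"] ord(1) by (simp add: order_def)
  also have "\<dots> = 1 + (\<Sum>Y\<in>?O - {{\<one>}}. card Y)"
    using one finO by (simp add: sum.remove)
  finally have "p ^ n = 1 + (\<Sum>Y\<in>?O - {{\<one>}}. card Y)" .
  moreover have "p dvd p ^ n" using ord(2) by simp
  moreover have "p dvd (\<Sum>Y\<in>?O - {{\<one>}}. card Y)" using dvd by (rule dvd_sum)
  ultimately have "p dvd 1" by (metis dvd_add_left_iff)
  then show False using p by simp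
qed

text \<open>If \<open>N = [N,G]\<close>, take a normal subgroup \<open>M\<close> not containing \<open>N\<close>, of maximal order.
  The preimage of the centre of \<open>G/M\<close> then contains \<open>N\<close>, whence \<open>N = [N,G] \<subseteq> M\<close>.\<close>
lemma p_group_commutator_subgroup_proper:
  assumes p: "Factorial_Ring.prime (p::nat)" and fin: "finite (carrier G)" and ord: "order G = p ^ n"
    and N: "subgroup N G" "N \<noteq> {\<one>}"
  shows "\<not> N \<subseteq> commutator_subgroup G N (carrier G)"
proof
  assume NN: "N \<subseteq> commutator_subgroup G N (carrier G)"
  let ?P = "\<lambda>M. M \<lhd> G \<and> \<not> N \<subseteq> M"
  have "?P {\<one>}" using N one_is_normal subgroup.one_closed[OF N(1)] by auto
  moreover have "card M < Suc (card (carrier G))" if "?P M" for M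
    using that fin by (auto simp: less_Suc_eq_le dest!: normal_imp_subgroup subgroup.subset intro: card_mono)
  ultimately obtain M where M: "?P M" and max: "\<And>M'. ?P M' \<Longrightarrow> card M' \<le> card M"
    using ex_has_greatest_nat[of ?P "{\<one>}" card "Suc (card (carrier G))"] by blast
  interpret M: normal M G using M by blast
  let ?Q = "G Mod M" and ?\<pi> = "\<lambda>a. M #> a"
  interpret Q: group ?Q by (rule M.factorgroup_is_group)
  interpret \<pi>: group_hom G ?Q ?\<pi> by (rule M.proj_group_hom)
  have cQ: "order ?Q * card M = p ^ n"
    using M.card_proj_image[OF subgroup_self M.subset] ord by (simp add: M.proj_surj order_def)
  then have "order ?Q dvd p ^ n" by (metis dvd_triv_left)
  then obtain j where j: "order ?Q = p ^ j" using divides_primepow_nat[OF p] by blast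
  have "j > 0"
  proof (rule ccontr)
    assume "\<not> j > 0"
    then have "card M = card (carrier G)" using cQ j ord by (simp add: order_def)
    then have "M = carrier G" using M.subset fin by (simp add: card_subset_eq)
    then show False using M subgroup.subset[OF N(1)] by blast
  qed
  moreover have "finite (carrier ?Q)" using fin by (simp add: M.proj_surj[symmetric])
  ultimately have "center ?Q \<noteq> {\<one>\<^bsub>?Q\<^esub>}"
    using Q.p_group_center_nontrivial[OF p _ j] by blast
  moreover have sZ: "subgroup (center ?Q) ?Q" by (rule Q.subgroup_centralizer) simp
  ultimately obtain z where z: "z \<in> center ?Q" "z \<noteq> \<one>\<^bsub>?Q\<^esub>"
    using subgroup.one_closed by blast
  let ?M' = "{x \<in> carrier G. ?\<pi> x \<in> center ?Q}"
  have comM: "commutator G x g \<in> M" if x: "x \<in> ?M'" and g: "g \<in> carrier G" for x g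
  proof -
    have "?\<pi> x \<otimes>\<^bsub>?Q\<^esub> ?\<pi> g = ?\<pi> g \<otimes>\<^bsub>?Q\<^esub> ?\<pi> x"
      using x \<pi>.hom_closed[OF g] unfolding mem_centralizer_iff mem_Collect_eq by metis
    then have "?\<pi> (commutator G x g) = \<one>\<^bsub>?Q\<^esub>"
      using x g Q.commutator_eq_one_iff by (simp only: \<pi>.commutator_img mem_Collect_eq \<pi>.hom_closed)
    then show ?thesis using M.proj_eq_one_iff x g by (simp only: mem_Collect_eq commutator_closed)
  qed
  have MM': "M \<subseteq> ?M'"
  proof
    fix x assume "x \<in> M"
    then have "x \<in> carrier G" "?\<pi> x = \<one>\<^bsub>?Q\<^esub>" using M.proj_eq_one_iff M.subset by blast+
    then show "x \<in> ?M'" using subgroup.one_closed[OF sZ] by simp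
  qed
  have sM': "subgroup ?M' G"
  proof
    fix x y assume "x \<in> ?M'" "y \<in> ?M'"
    then show "x \<otimes> y \<in> ?M'"
      using subgroup.m_closed[OF sZ] by (simp del: mult_FactGroup)
  next
    fix x assume "x \<in> ?M'"
    then show "inv x \<in> ?M'" using subgroup.m_inv_closed[OF sZ] by simp
  qed (use subgroup.one_closed[OF sZ] in auto)
  have "?M' \<lhd> G"
  proof (rule normal_invI[OF sM'])
    fix g x assume g: "g \<in> carrier G" and x: "x \<in> ?M'"
    then have "commutator G g x \<otimes> x \<in> ?M'"
      using commutator_flip_mem[OF M.subgroup_axioms _ g comM[OF x g]] MM'
        subgroup.m_closed[OF sM' _ x] by blast
    then show "g \<otimes> x \<otimes> inv g \<in> ?M'" using g x by (simp add: commutator_def m_assoc)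
  qed
  moreover have "M \<subset> ?M'"
  proof -
    obtain x where x: "x \<in> carrier G" "z = ?\<pi> x"
      using z(1) M.proj_surj unfolding mem_centralizer_iff by blast
    then have "x \<notin> M" using z(2) M.proj_eq_one_iff by blast
    then show ?thesis using MM' x z(1) by blast
  qed
  then have "card M < card ?M'" using fin by (intro psubset_card_mono) auto
  \<comment> \<open>\<open>?M'\<close> is normal and larger than \<open>M\<close>, so by maximality
    it must contain \<open>N\<close>.\<close>
  ultimately have "N \<subseteq> ?M'" using max leD by blast
  then have "commutator_subgroup G N (carrier G) \<subseteq> M"
    using comM by (subst commutator_subgroup_subset_iff[OF M.subgroup_axioms]) blast
  then show False using NN M by blast
qed

text \<open>Nilpotency of finite \<open>p\<close>-groups, in the form of strict descent that the
  counting of indices needs.\<close>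

lemma lower_central_psubset:
  assumes "Factorial_Ring.prime (p::nat)" "finite (carrier G)" "order G = p ^ m"
    and "n > 0" "lower_central G n \<noteq> {\<one>}"
  shows "lower_central G (Suc n) \<subset> lower_central G n"
  using p_group_commutator_subgroup_proper[OF assms(1-3) lower_central_subgroup assms(5)]
    lower_central_Suc_subset[of n] lower_central_Suc[OF assms(4)] by auto

section \<open>Locating the second derived subgroup in the lower central series\<close>

text \<open>The centre of \<open>A\<close> lies between \<open>B\<close> and \<open>A\<close>, so it
  is one of the two; it cannot be \<open>B\<close>, since a centre never has prime index.\<close>

lemma derived_abelian_of_central_prime_index:
  assumes p: "Factorial_Ring.prime (p::nat)" and "finite A" and A: "subgroup A G" and B: "subgroup B G"
    and "B \<subseteq> A" "B \<subseteq> centralizer G A" and card: "card A = p * card B"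
  shows "derived G A = {\<one>}"
proof -
  let ?Z = "A \<inter> centralizer G A"
  have sA: "A \<subseteq> carrier G" using A by (rule subgroup.subset)
  have "?Z = B \<or> ?Z = A"
    by (rule subgroup_between_prime_index[OF p assms(2) card B _ A])
       (use assms sA in \<open>auto intro: subgroup_Int_centralizer\<close>)
  moreover have "?Z \<noteq> B" using center_index_not_prime[OF p assms(2) A] card by metis
  ultimately show ?thesis unfolding derived_trivial_iff[OF sA] by blast
qed

text \<open>Reduces inclusions of G'' in \<open>M\<close> to \<open>G/M\<close>, using that the
  projection carries derived subgroups onto derived subgroups.\<close>

lemma derived_derived_trivial_iff_proj:
  assumes "M \<lhd> G"
  shows "derived (G Mod M) (derived (G Mod M) (carrier (G Mod M))) = {\<one>\<^bsub>G Mod M\<^esub>}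
    \<longleftrightarrow> derived G (derived G (carrier G)) \<subseteq> M"
proof -
  interpret M: normal M G by fact
  have sA: "derived G (carrier G) \<subseteq> carrier G" by (rule derived_in_carrier) simp
  have "derived (G Mod M) (derived (G Mod M) (carrier (G Mod M)))
      = (\<lambda>a. M #> a) ` derived G (derived G (carrier G))"
    by (simp only: M.proj_surj[symmetric] M.proj_derived[OF order_refl] M.proj_derived[OF sA])
  then show ?thesis
    using M.proj_image_eq_one_iff[OF derived_is_subgroup[OF sA]] by (simp only:)
qed

lemma proj_lower_central_trivial:
  "lower_central (G Mod lower_central G n) n = {\<one>\<^bsub>G Mod lower_central G n\<^esub>}"
  by (simp only: normal.proj_lower_central[OF lower_central_normal] order_refl
      normal.proj_image_eq_one_iff[OF lower_central_normal lower_central_subgroup])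

text \<open>Modulo \<open>G\<^sub>4\<close>, the subgroup \<open>G\<^sub>2\<close> centralizes
  itself.\<close>

lemma derived_derived_subset_lower_central_4:
  "derived G (derived G (carrier G)) \<subseteq> lower_central G 4"
proof -
  let ?Q = "G Mod lower_central G 4"
  interpret Q: group ?Q by (rule normal.factorgroup_is_group[OF lower_central_normal])
  have "lower_central ?Q (Suc (Suc 2)) = {\<one>\<^bsub>?Q\<^esub>}"
    using proj_lower_central_trivial[of 4] by (simp del: one_FactGroup)
  then have "derived ?Q (carrier ?Q) \<subseteq> centralizer ?Q (derived ?Q (carrier ?Q))"
    using Q.lower_central_centralizes_derived[of 2] by (simp add: lower_central_2)
  then have "derived ?Q (derived ?Q (carrier ?Q)) = {\<one>\<^bsub>?Q\<^esub>}"
    by (subst Q.derived_trivial_iff) (simp_all add: Q.derived_in_carrier)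
  then show ?thesis using derived_derived_trivial_iff_proj[OF lower_central_normal] by blast
qed

text \<open>Modulo \<open>G\<^sub>5\<close>, the subgroup \<open>G\<^sub>3\<close> is central of
  index \<open>p\<close> in \<open>G\<^sub>2\<close>, which is therefore abelian.\<close>

lemma derived_derived_subset_lower_central_5:
  assumes p: "Factorial_Ring.prime (p::nat)" and fin: "finite (carrier G)"
    and card: "card (derived G (carrier G)) = p * card (lower_central G 3)"
  shows "derived G (derived G (carrier G)) \<subseteq> lower_central G 5"
proof -
  let ?D = "lower_central G 5" let ?Q = "G Mod ?D" let ?\<pi> = "\<lambda>a. ?D #> a"
  interpret D: normal ?D G by (rule lower_central_normal)
  interpret Q: group ?Q by (rule D.factorgroup_is_group)
  have sub: "?D \<subseteq> lower_central G 3" "lower_central G 3 \<subseteq> lower_central G 2"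
    using lower_central_Suc_subset[of 2] lower_central_Suc_subset[of 3] lower_central_Suc_subset[of 4]
    by (simp_all add: eval_nat_numeral)
  have "finite ?D" using fin D.subset finite_subset by blast
  then have D0: "card ?D > 0" using D.one_closed card_gt_0_iff by blast
  have c: "card (lower_central ?Q 2) * card ?D = card (lower_central G 2)"
    "card (lower_central ?Q 3) * card ?D = card (lower_central G 3)"
    unfolding D.proj_lower_central
    using D.card_proj_image[OF lower_central_subgroup] sub by (meson order_trans)+
  have "card (lower_central ?Q 2) * card ?D = p * card (lower_central ?Q 3) * card ?D"
    by (simp only: mult.assoc c card[folded lower_central_2])
  then have cardQ: "card (lower_central ?Q 2) = p * card (lower_central ?Q 3)" using D0 by simp
  have "lower_central ?Q (Suc (Suc 3)) = {\<one>\<^bsub>?Q\<^esub>}"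
    using proj_lower_central_trivial[of 5] by (simp del: one_FactGroup)
  then have "lower_central ?Q 3 \<subseteq> centralizer ?Q (lower_central ?Q 2)"
    using Q.lower_central_centralizes_derived[of 3] by (simp add: lower_central_2)
  moreover have "lower_central ?Q 3 \<subseteq> lower_central ?Q 2"
    using Q.lower_central_Suc_subset[of 2] by (simp add: eval_nat_numeral)
  moreover have "finite (lower_central ?Q 2)"
    unfolding D.proj_lower_central using fin subgroup.subset[OF lower_central_subgroup] finite_subset by blast
  ultimately have "derived ?Q (lower_central ?Q 2) = {\<one>\<^bsub>?Q\<^esub>}"
    using Q.derived_abelian_of_central_prime_index[OF p _ Q.lower_central_subgroup Q.lower_central_subgroup
        _ _ cardQ] by blast
  then show ?thesis
    using derived_derived_trivial_iff_proj[OF lower_central_normal, of 5] by (simp only: lower_central_2)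
qed

text \<open>If \<open>G\<^sub>4\<close> were nontrivial, dividing by a subgroup \<open>M\<close> of
  index \<open>p\<close> in it would reach the setting of
  \<open>derived_abelian_of_small_factors\<close>. That gives G'' in \<open>M\<close>, a proper
  subgroup of \<open>G\<^sub>4\<close>.\<close>

lemma derived_abelian_of_class_4:
  assumes p: "Factorial_Ring.prime (p::nat)" "p \<noteq> 2" and fin: "finite (carrier G)" and ord: "order G = p ^ n"
    and class4: "lower_central G 5 = {\<one>}"
    and card: "card (lower_central G 2) = p ^ 2 * card (lower_central G 3)"
      "card (lower_central G 3) = p * card (lower_central G 4)"
    and eq: "derived G (derived G (carrier G)) = lower_central G 4"
  shows "lower_central G 4 = {\<one>}"
proof (rule ccontr)
  let ?C = "lower_central G 4"
  assume C1: "?C \<noteq> {\<one>}"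
  have C: "subgroup ?C G" by (rule lower_central_subgroup)
  interpret C: group "G\<lparr>carrier := ?C\<rparr>" by (rule subgroup_imp_group[OF C])
  have finC: "finite ?C" using fin subgroup.subset[OF C] finite_subset by blast
  have "card ?C dvd p ^ n"
    using card_subgroup_dvd[OF C subgroup_self subgroup.subset[OF C]] ord by (simp add: order_def)
  then obtain j where j: "card ?C = p ^ j" using divides_primepow_nat[OF p(1)] by blast
  have "j \<noteq> 0"
  proof
    assume "j = 0"
    then obtain c where "?C = {c}" using j by (auto simp: card_1_singleton_iff)
    then show False using C1 subgroup.one_closed[OF C] by auto
  qed
  then obtain i where i: "j = Suc i" using not0_implies_Suc by blast
  \<comment> \<open>Sylow's theorem inside \<open>?C\<close>, with exponent \<open>i\<close> and
    cofactor \<open>p\<close>, supplies a subgroup of index \<open>p\<close>. It is normal in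
    \<open>G\<close> because \<open>?C\<close> is central.\<close>
  obtain M where M': "subgroup M (G\<lparr>carrier := ?C\<rparr>)" "card M = p ^ i"
    using sylow_thm[OF p(1) C.is_group, of i p] finC j i by (auto simp: order_def)
  have M: "subgroup M G" "M \<subseteq> ?C"
    using incl_subgroup[OF C M'(1)] subgroup.subset[OF M'(1)] by auto
  have cardM: "card ?C = p * card M" "card M > 0" using j i M'(2) prime_gt_0_nat[OF p(1)] by simp_all
  have "lower_central G (Suc 4) = {\<one>}" using class4 by simp
  then have "M \<subseteq> center G" using M(2) lower_central_Suc_trivial[of 4] by auto
  then have MG: "M \<lhd> G" by (rule normal_central[OF M(1)])
  interpret M: normal M G by (rule MG)
  let ?Q = "G Mod M"
  interpret Q: group ?Q by (rule M.factorgroup_is_group)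
  have sub: "lower_central G 4 \<subseteq> lower_central G 3" "lower_central G 3 \<subseteq> lower_central G 2"
    using lower_central_Suc_subset[of 2] lower_central_Suc_subset[of 3] by (simp_all add: eval_nat_numeral)
  have subQ: "lower_central ?Q 4 \<subseteq> lower_central ?Q 3" "lower_central ?Q 3 \<subseteq> lower_central ?Q 2"
    using Q.lower_central_Suc_subset[of 2] Q.lower_central_Suc_subset[of 3] by (simp_all add: eval_nat_numeral)
  have cQ: "card (lower_central ?Q k) * card M = card (lower_central G k)" if "k \<in> {2, 3, 4}" for k
    unfolding M.proj_lower_central
    by (rule M.card_proj_image[OF lower_central_subgroup]) (use that M(2) sub in auto)
  have c: "card (lower_central ?Q 2) * card M = card (lower_central G 2)"
    "card (lower_central ?Q 3) * card M = card (lower_central G 3)"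
    "card (lower_central ?Q 4) * card M = card ?C"
    by (rule cQ; simp)+
  have "card (lower_central ?Q 2) * card M = p ^ 2 * card (lower_central ?Q 3) * card M"
    "card (lower_central ?Q 3) * card M = p * card (lower_central ?Q 4) * card M"
    "card (lower_central ?Q 4) * card M = p * card M"
    by (simp_all only: mult.assoc c card cardM(1))
  then have cardQ: "card (lower_central ?Q 2) = p ^ 2 * card (lower_central ?Q 3)"
    "card (lower_central ?Q 3) = p * card (lower_central ?Q 4)" "card (lower_central ?Q 4) = p"
    using cardM(2) by simp_all
  have "lower_central ?Q (Suc 4) = (\<lambda>a. M #> a) ` {\<one>}"
    using class4 unfolding M.proj_lower_central by simp
  then have "lower_central ?Q (Suc 4) = {\<one>\<^bsub>?Q\<^esub>}"
    using M.proj_eq_one_iff[OF one_closed] M.one_closed by simp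
  then have cen: "lower_central ?Q 4 \<subseteq> center ?Q" by (intro Q.lower_central_Suc_trivial) simp_all
  \<comment> \<open>If the third term of the quotient were central, the fourth would be trivial
    instead of having order \<open>p\<close>.\<close>
  have nontriv: "\<not> lower_central ?Q 3 \<subseteq> center ?Q"
  proof
    assume *: "lower_central ?Q 3 \<subseteq> center ?Q"
    have "commutator ?Q w g = \<one>\<^bsub>?Q\<^esub>" if w: "w \<in> lower_central ?Q 3" and g: "g \<in> carrier ?Q" for w g
    proof -
      have "w \<in> center ?Q" using * w by blast
      then have "w \<in> carrier ?Q" "w \<otimes>\<^bsub>?Q\<^esub> g = g \<otimes>\<^bsub>?Q\<^esub> w"
        using g unfolding mem_centralizer_iff by blast+
      then show ?thesis using Q.commutator_eq_one_iff g by blast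
    qed
    then have "lower_central ?Q 4 \<subseteq> {\<one>\<^bsub>?Q\<^esub>}"
      unfolding lower_central_numeral Q.lower_central_numeral(2)
      by (subst Q.commutator_subgroup_subset_iff[OF Q.triv_subgroup]) blast
    then have "card (lower_central ?Q 4) \<le> card {\<one>\<^bsub>?Q\<^esub>}"
      by (intro card_mono) simp_all
    then show False using cardQ(3) prime_gt_1_nat[OF p(1)] by simp
  qed
  have "finite (carrier ?Q)" using fin by (simp add: M.proj_surj[symmetric])
  then have "derived ?Q (derived ?Q (carrier ?Q)) = {\<one>\<^bsub>?Q\<^esub>}"
  proof (rule Q.derived_abelian_of_small_factors[OF _ p Q.lower_central_subgroup Q.lower_central_subgroup
        subQ(1) _ cen _ cardQ(2,3) _ _ Q.derived_derived_subset_lower_central_4 nontriv])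
    show "lower_central ?Q 3 \<subseteq> derived ?Q (carrier ?Q)"
      "card (derived ?Q (carrier ?Q)) = p ^ 2 * card (lower_central ?Q 3)"
      using subQ(2) cardQ(1) by (simp_all only: lower_central_2)
    show "commutator ?Q g w \<in> lower_central ?Q 3" if "g \<in> carrier ?Q" "w \<in> derived ?Q (carrier ?Q)" for g w
      using Q.lower_central_commutator(2)[of 2 w g] that by (simp add: commutator_subgroup_self eval_nat_numeral)
    show "commutator ?Q g b \<in> lower_central ?Q 4" if "g \<in> carrier ?Q" "b \<in> lower_central ?Q 3" for g b
      using Q.lower_central_commutator(2)[of 3 b g] that by (simp add: eval_nat_numeral)
  qed
  then have "?C \<subseteq> M" using derived_derived_trivial_iff_proj[OF MG] eq by simp
  then have "?C = M" using M(2) by blast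
  then show False using cardM prime_gt_1_nat[OF p(1)] by simp
qed

section \<open>Indices as powers of \<open>p\<close> and the final count\<close>

lemma p_group_subgroup_index:
  assumes "Factorial_Ring.prime (p::nat)" "finite (carrier G)" "order G = p ^ n"
    and "subgroup H G" "subgroup K G" "H \<subseteq> K"
  obtains i where "card K = p ^ i * card H" "i = 0 \<longleftrightarrow> H = K"
proof -
  have fin: "finite K" using assms subgroup.subset finite_subset by metis
  obtain k where k: "card K = card H * k" using card_subgroup_dvd[OF assms(4-6)] by (auto elim: dvdE)
  have "card K dvd p ^ n"
    using card_subgroup_dvd[OF assms(5) subgroup_self subgroup.subset[OF assms(5)]] assms(3)
    by (simp add: order_def)
  then have "k dvd p ^ n" using k by (metis dvd_mult_right)
  then obtain i where i: "k = p ^ i" using divides_primepow_nat[OF assms(1)] by blast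
  have "card H > 0"
    using assms(6) fin subgroup.one_closed[OF assms(4)] card_gt_0_iff finite_subset by blast
  then have "card H = card K \<longleftrightarrow> 1 = p ^ i" unfolding k i by simp
  moreover have "p ^ i = 1 \<longleftrightarrow> i = 0" using prime_gt_1_nat[OF assms(1)] by auto
  ultimately have "i = 0 \<longleftrightarrow> card H = card K" by metis
  also have "\<dots> \<longleftrightarrow> H = K" using card_subset_eq[OF fin assms(6)] by blast
  finally show ?thesis using that[of i] k i by (simp add: mult.commute)
qed

lemma order_subgroup_Mod:
  assumes "subgroup K G" "subgroup H G" "H \<subseteq> K"
  shows "order (G\<lparr>carrier := K\<rparr> Mod H) * card H = card K"
  using group.lagrange[OF subgroup_imp_group[OF assms(1)] subgroup_incl[OF assms(2,1,3)]]
  by (simp add: order_def FactGroup_def)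

end

theorem theorem1p1:
  fixes G (structure) and p n :: nat
  assumes "Factorial_Ring.prime p" and "p \<ge> 3"
    and "group G" and "finite (carrier G)" and "order G = p ^ n"
    and "order (G\<lparr>carrier := derived G (carrier G)\<rparr> Mod derived G (derived G (carrier G))) = p ^ 3"
    and "derived G (derived G (carrier G)) \<noteq> {\<one>}"
  shows "order (G\<lparr>carrier := derived G (carrier G)\<rparr> Mod lower_central G 3) = p
       \<and> derived G (derived G (carrier G)) = lower_central G 5"
proof -
  interpret group G by fact
  note pg = assms(1,4,5)
  let ?A = "lower_central G 2" and ?B = "lower_central G 3" and ?C = "lower_central G 4"
    and ?D = "lower_central G 5" and ?S = "derived G (derived G (carrier G))"
  have lc: "subgroup (lower_central G k) G" for k by (rule lower_central_subgroup)
  have A: "?A = derived G (carrier G)" by (rule lower_central_2)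
  have S: "subgroup ?S G" unfolding A[symmetric] by (rule derived_is_subgroup[OF subgroup.subset[OF lc]])
  have SC: "?S \<subseteq> ?C" by (rule derived_derived_subset_lower_central_4)
  have CB: "?C \<subseteq> ?B" and BA: "?B \<subseteq> ?A" and DC: "?D \<subseteq> ?C"
    using lower_central_Suc_subset[of 2] lower_central_Suc_subset[of 3] lower_central_Suc_subset[of 4]
    by (simp_all add: eval_nat_numeral)
  \<comment> \<open>The terms down to \<open>?C\<close> contain the nontrivial G'', so the series
    descends strictly as far as \<open>?D\<close>.\<close>
  have "?C \<noteq> {\<one>}" using SC assms(7) subgroup.one_closed[OF S] by blast
  moreover from this have "?B \<noteq> {\<one>}" "?A \<noteq> {\<one>}"
    using CB BA subgroup.one_closed[OF lc] by blast+
  ultimately have ne: "?D \<noteq> ?C" "?C \<noteq> ?B" "?B \<noteq> ?A"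
    using lower_central_psubset[OF pg, of 2] lower_central_psubset[OF pg, of 3]
      lower_central_psubset[OF pg, of 4] by (auto simp: eval_nat_numeral)
  obtain j where j: "card ?A = p ^ j * card ?B" "j = 0 \<longleftrightarrow> ?B = ?A"
    by (rule p_group_subgroup_index[OF pg lc lc BA])
  obtain i where i: "card ?B = p ^ i * card ?C" "i = 0 \<longleftrightarrow> ?C = ?B"
    by (rule p_group_subgroup_index[OF pg lc lc CB])
  obtain k where k: "card ?C = p ^ k * card ?S" "k = 0 \<longleftrightarrow> ?S = ?C"
    by (rule p_group_subgroup_index[OF pg S lc SC])
  have card0: "card H > 0" if "subgroup H G" for H
  proof -
    have "finite H" using subgroup.subset[OF that] assms(4) by (rule finite_subset)
    then show ?thesis using subgroup.one_closed[OF that] card_gt_0_iff by blast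
  qed
  have SA: "?S \<subseteq> ?A" using SC CB BA by blast
  have "card ?A = p ^ 3 * card ?S"
    using order_subgroup_Mod[OF lc S SA] assms(6) A by simp
  then have "p ^ (j + i + k) * card ?S = p ^ 3 * card ?S"
    using i(1) j(1) k(1) by (simp add: power_add mult.assoc)
  then have "p ^ (j + i + k) = p ^ 3" using card0[OF S] by simp
  then have sum: "j + i + k = 3" using prime_gt_1_nat[OF assms(1)] by simp
  have ij: "i \<ge> 1" "j \<ge> 1" using i(2) j(2) ne by auto
  have "j = 1"
  \<comment> \<open>The exponents satisfy \<open>i, j \<ge> 1\<close> and
    \<open>j + i + k = 3\<close>, so the only alternative is \<open>j = 2\<close>,
    \<open>i = 1\<close>, \<open>k = 0\<close>. Dividing by \<open>?D\<close> preserves these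
    indices and the equality of G'' with the fourth term, and makes the fifth term trivial.\<close>
  proof (rule ccontr)
    assume "j \<noteq> 1"
    then have "j = 2" "i = 1" and SeqC: "?S = ?C" using sum ij k(2) by auto
    then have card: "card ?A = p ^ 2 * card ?B" "card ?B = p * card ?C" using i j by simp_all
    interpret D: normal ?D G by (rule lower_central_normal)
    let ?Q = "G Mod ?D"
    interpret Q: group ?Q by (rule D.factorgroup_is_group)
    have c: "card (lower_central ?Q 2) * card ?D = card ?A"
      "card (lower_central ?Q 3) * card ?D = card ?B"
      "card (lower_central ?Q 4) * card ?D = card ?C"
      unfolding D.proj_lower_central using D.card_proj_image[OF lc] DC CB BA by (meson order_trans)+
    have "card (lower_central ?Q 2) * card ?D = p ^ 2 * card (lower_central ?Q 3) * card ?D"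
      "card (lower_central ?Q 3) * card ?D = p * card (lower_central ?Q 4) * card ?D"
      by (simp_all only: mult.assoc c card)
    then have cardQ: "card (lower_central ?Q 2) = p ^ 2 * card (lower_central ?Q 3)"
      "card (lower_central ?Q 3) = p * card (lower_central ?Q 4)"
      using card0[OF lc, of 5] by simp_all
    have "order ?Q * card ?D = p ^ n"
      using D.card_proj_image[OF subgroup_self D.subset] assms(5) by (simp add: D.proj_surj order_def)
    then have "order ?Q dvd p ^ n" by (metis dvd_triv_left)
    then obtain m where m: "order ?Q = p ^ m" using divides_primepow_nat[OF assms(1)] by blast
    have fin: "finite (carrier ?Q)" using assms(4) by (simp add: D.proj_surj[symmetric])
    have "derived ?Q (derived ?Q (carrier ?Q)) = (\<lambda>a. ?D #> a) ` ?S"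
      unfolding D.proj_surj[symmetric] A[symmetric]
      by (simp only: D.proj_derived[OF order_refl] D.proj_derived[OF subgroup.subset[OF lc]] A[symmetric])
    then have "derived ?Q (derived ?Q (carrier ?Q)) = lower_central ?Q 4"
      unfolding SeqC D.proj_lower_central .
    then have "lower_central ?Q 4 = {\<one>\<^bsub>?Q\<^esub>}"
      using Q.derived_abelian_of_class_4[OF assms(1) _ fin m proj_lower_central_trivial cardQ] assms(2)
      by simp
    then have "?C \<subseteq> ?D"
      unfolding D.proj_lower_central D.proj_image_eq_one_iff[OF lc] .
    then show False using DC ne by blast
  qed
  then have cardA: "card ?A = p * card ?B" using j by simp
  then have SD: "?S \<subseteq> ?D"
    using derived_derived_subset_lower_central_5[OF assms(1,4)] A by simp
  obtain l where l: "card ?C = p ^ l * card ?D" "l = 0 \<longleftrightarrow> ?D = ?C"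
    by (rule p_group_subgroup_index[OF pg lc lc DC])
  obtain q where q: "card ?D = p ^ q * card ?S" "q = 0 \<longleftrightarrow> ?S = ?D"
    by (rule p_group_subgroup_index[OF pg S lc SD])
  have "p ^ (l + q) * card ?S = p ^ k * card ?S"
    using k(1) l(1) q(1) by (simp add: power_add mult.assoc)
  then have "p ^ (l + q) = p ^ k" using card0[OF S] by simp
  then have "l + q = k" using prime_gt_1_nat[OF assms(1)] by simp
  \<comment> \<open>With \<open>j = 1\<close> and \<open>i \<ge> 1\<close>, at most one factor
    \<open>p\<close> is left for \<open>k = l + q\<close>; since \<open>?D \<noteq> ?C\<close>, it
    is taken by \<open>l\<close>.\<close>
  then have "q = 0" using sum ij \<open>j = 1\<close> l(2) ne by auto
  moreover have "order (G\<lparr>carrier := ?A\<rparr> Mod ?B) * card ?B = p * card ?B"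
    using order_subgroup_Mod[OF lc lc BA] cardA by simp
  then have "order (G\<lparr>carrier := ?A\<rparr> Mod ?B) = p" using card0[OF lc, of 3] by simp
  ultimately show ?thesis using q(2) A by simp
qed

end
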